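(* Let $\ell\in\mathbb R$, $a_0\in\mathbb R\setminus\{0\}$, $s_0>0$. Let $(\chi(s),a(s))$ be the solution of the system $$\chi'_s=\frac{a-2\chi(\ell+2\chi a)}{2s},\qquad a'_s=-2s\chi+\frac as(\ell+2\chi a)$$ with $(\chi(s_0),a(s_0))=(0,a_0)$, and let $w(s)=\frac{a(s)}{2s\chi(s)}$ be the corresponding solution of the Painlevé 3 equation $$w''=\frac{(w')^2}w-\frac{w'}{s}-2\ell\frac{w^2}{s}+(2\ell-2)\frac1s+w^3-\frac1w.$$ The Poincaré map $\mathcal P:\mathbf{Jos}^o\to\mathbf{Jos}^o$ is well-defined at the point $(\ell,0,a_0,s_0)$ if and only if $w$ is holomorphic on a finite interval $(s_0,s_1)$, has a pole with residue one at $s_1$ and has no zeros with unit derivative (i.e. zeros where $w'=1$) in $(s_0,s_1)$.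
   Context: $\mathbf{Jos}^o=\{(\ell,\chi,a,s)\in\mathbb R^4:\ \chi=0,\ s>0,\ a\neq0\}$. The Poincaré map $\mathcal P$ is well-defined at $(\ell,0,a_0,s_0)\in\mathbf{Jos}^o$ if, for the solution $(\chi(s),a(s))$ of the system with $(\chi(s_0),a(s_0))=(0,a_0)$, there is a next point $s_1>s_0$ where $\chi(s_1)=0$, and $(\chi(s),a(s))$ is well-defined (finite) on the whole segment $[s_0,s_1]$; then $\mathcal P(\ell,0,a_0,s_0)=(\ell,0,a(s_1),s_1)$. The function $w$ is known to be a solution of the Painlevé 3 equation and to be meromorphic on the universal cover of $\mathbb C\setminus\{0\}$; in particular it is defined as a meromorphic function along the whole positive semiaxis, where it is considered here. *)

theory Defs
  imports "HOL-Complex_Analysis.Complex_Analysis"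
begin

definition Jos_o :: "(real \<times> real \<times> real \<times> real) set" where
  "Jos_o = {(l, chi, a, s). chi = 0 \<and> s > 0 \<and> a \<noteq> 0}"

text \<open>For \<open>I\<close> a closed interval the derivatives at the endpoints are one-sided.\<close>

definition solves_system ::
  "real \<Rightarrow> (real \<Rightarrow> real) \<Rightarrow> (real \<Rightarrow> real) \<Rightarrow> real set \<Rightarrow> bool" where
  "solves_system l chi a I \<longleftrightarrow>
     (\<forall>s\<in>I.
        (chi has_real_derivative
           (a s - 2 * chi s * (l + 2 * chi s * a s)) / (2 * s)) (at s within I) \<and>
        (a has_real_derivative
           - 2 * s * chi s + a s / s * (l + 2 * chi s * a s)) (at s within I))"

text \<open>
  The graph of the (partial) Poincare map. The functions \<open>chi\<close>, \<open>a\<close> take finite values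
  and satisfy the system on all of \<open>{s0..s1}\<close>, and \<open>s1\<close> is the first return of \<open>chi\<close>
  to zero after \<open>s0\<close>. Solutions of the initial value problem being unique, this describes
  the behaviour of the maximal solution starting at the given point.
\<close>

definition poincare_graph ::
  "((real \<times> real \<times> real \<times> real) \<times> (real \<times> real \<times> real \<times> real)) set" where
  "poincare_graph =
     {((l, 0, a0, s0), (l, 0, a s1, s1)) | l a0 s0 chi a s1.
        (l, 0, a0, s0) \<in> Jos_o \<and> s0 < s1 \<and>
        solves_system l chi a {s0..s1} \<and> chi s0 = 0 \<and> a s0 = a0 \<and>
        chi s1 = 0 \<and> (\<forall>s\<in>{s0<..<s1}. chi s \<noteq> 0)}"

definition poincare_well_defined_at :: "real \<times> real \<times> real \<times> real \<Rightarrow> bool" where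
  "poincare_well_defined_at p \<longleftrightarrow> p \<in> Domain poincare_graph"

abbreviation pos_axis :: "complex set" where
  "pos_axis \<equiv> complex_of_real ` {0<..}"

text \<open>
  A meromorphic function along the positive semiaxis solving Painleve 3. The equation is
  required at the regular points where its right-hand side makes sense. The library's nice
  meromorphicity means that \<open>w\<close> takes its analytic value at every removable singularity.
\<close>

definition meromorphic_P3_solution :: "real \<Rightarrow> (complex \<Rightarrow> complex) \<Rightarrow> bool" where
  "meromorphic_P3_solution l w \<longleftrightarrow>
     w nicely_meromorphic_on pos_axis \<and>
     (\<forall>z\<in>pos_axis. w analytic_on {z} \<and> w z \<noteq> 0 \<longrightarrow>
        deriv (deriv w) z =
          (deriv w z)\<^sup>2 / w z - deriv w z / z - 2 * of_real l * (w z)\<^sup>2 / z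
          + (2 * of_real l - 2) * (1 / z) + (w z) ^ 3 - 1 / w z)"

end

theory Submission
  imports Defs
begin

text \<open>
  Along the flow, \<open>w = a / (2 s \<chi>)\<close> and \<open>v = 1 / w\<close> satisfy, with \<open>u = \<chi> a\<close>,
  \<open>w' = - 1 - w^2 + (w / s) (2 l - 1 + 4 u)\<close> and \<open>v' = 1 + v^2 - (v / s) (2 l - 1 + 4 u)\<close>.
  Solving for \<open>u\<close>, the function \<open>u\<close> stays holomorphic at a point \<open>t\<close> as long as \<open>w\<close> is regular
  there and either \<open>w(t) \<noteq> 0\<close> or \<open>w'(t) = - 1\<close>, and also at a simple pole with \<open>v'(t) = 1\<close>,
  that is, of residue one. In these cases the linear equations \<open>\<chi>' = \<chi> (w - (l + 2 u) / s)\<close>,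
  respectively \<open>a' = a ((l + 2 u) / s - v)\<close>, continue the solution holomorphically across \<open>t\<close>: the
  system persists by the identity theorem, and \<open>\<chi>\<close> vanishes exactly at the poles of residue one.
  The Painleve equation enters only to show that \<open>w' = 1\<close> or \<open>w' = - 1\<close> at a zero of \<open>w\<close> and
  \<open>v' = 1\<close> or \<open>v' = - 1\<close> at a pole.
\<close>


section \<open>Uniqueness for the real system\<close>

text \<open>The derivative at \<open>s\<close> within \<open>I\<close> depends only on
  \<open>I\<close> near \<open>s\<close>. The local witnesses may differ from \<open>chi\<close>,
  \<open>a\<close> outside \<open>U\<close> and live on a set \<open>K\<close> larger than
  \<open>I \<inter> U\<close>; this is the shape in which glued pieces arrive.\<close>

lemma solves_system_local:
  assumes "\<And>s. s \<in> I \<Longrightarrow> \<exists>U K chi' a'. open U \<and> s \<in> U \<and> I \<inter> U \<subseteq> K \<and> solves_system l chi' a' K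
             \<and> (\<forall>x\<in>I \<inter> U. chi x = chi' x \<and> a x = a' x)"
  shows "solves_system l chi a I"
  unfolding solves_system_def
proof
  fix s assume s: "s \<in> I"
  obtain U K chi' a' where U: "open U" "s \<in> U" "I \<inter> U \<subseteq> K" "solves_system l chi' a' K"
    and eq: "\<And>x. x \<in> I \<inter> U \<Longrightarrow> chi x = chi' x \<and> a x = a' x"
    using assms[OF s] by metis
  have at: "at s within I = at s within (I \<inter> U)"
    by (rule at_within_nhd[of s U]) (use U in auto)
  have *: "(chi' has_real_derivative
           (a' s - 2 * chi' s * (l + 2 * chi' s * a' s)) / (2 * s)) (at s within I)"
          "(a' has_real_derivative
           - 2 * s * chi' s + a' s / s * (l + 2 * chi' s * a' s)) (at s within I)"
    using U s unfolding at by (auto simp: solves_system_def intro: has_field_derivative_subset)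
  have eq_s: "chi s = chi' s" "a s = a' s" using eq[of s] s U by auto
  have ev: "\<forall>\<^sub>F x in at s within I. x \<in> I \<inter> U"
    using U s by (auto simp: eventually_at_topological)
  have "\<forall>\<^sub>F x in at s within I. chi x = chi' x" "\<forall>\<^sub>F x in at s within I. a x = a' x"
    using ev eq by (auto elim!: eventually_mono)
  then show "(chi has_real_derivative
           (a s - 2 * chi s * (l + 2 * chi s * a s)) / (2 * s)) (at s within I) \<and>
        (a has_real_derivative
           - 2 * s * chi s + a s / s * (l + 2 * chi s * a s)) (at s within I)"
    using * eq_s s by (auto simp: has_field_derivative_cong_eventually)
qed

lemma solves_system_subset:
  assumes "solves_system l chi a I" "K \<subseteq> I"
  shows "solves_system l chi a K"
  using assms by (auto simp: solves_system_def intro: has_field_derivative_subset)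

lemma solves_systemD:
  assumes "solves_system l chi a I" "s \<in> I"
  shows "(chi has_real_derivative (a s - 2 * chi s * (l + 2 * chi s * a s)) / (2 * s)) (at s within I)"
    and "(a has_real_derivative - 2 * s * chi s + a s / s * (l + 2 * chi s * a s)) (at s within I)"
  using assms by (auto simp: solves_system_def)

lemma solves_system_continuous:
  assumes "solves_system l chi a I"
  shows "continuous_on I chi" "continuous_on I a"
  using solves_systemD[OF assms] by (auto intro!: DERIV_continuous_on)

text \<open>Two-sided Gronwall argument: the bound makes \<open>D s * exp (- K * s)\<close>
  nonincreasing and \<open>D s * exp (K * s)\<close> nondecreasing. The first spreads the zero at
  \<open>c\<close> forwards, the second backwards.\<close>

lemma zero_of_self_bounded_derivative:
  fixes D :: "real \<Rightarrow> real"
  assumes "p \<le> q" "\<And>s. s \<in> {p..q} \<Longrightarrow> (D has_real_derivative D' s) (at s within {p..q})"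
    and "\<And>s. s \<in> {p..q} \<Longrightarrow> \<bar>D' s\<bar> \<le> K * D s" and "\<And>s. s \<in> {p..q} \<Longrightarrow> D s \<ge> 0"
    and "c \<in> {p..q}" "D c = 0" "s \<in> {p..q}"
  shows "D s = 0"
proof -
  have up: "D y * exp (- K * y) \<le> D x * exp (- K * x)" if "x \<le> y" "{x..y} \<subseteq> {p..q}" for x y
  proof (rule DERIV_nonpos_imp_decreasing_open[OF that(1)])
    show "continuous_on {x..y} (\<lambda>s. D s * exp (- K * s))"
      using DERIV_continuous_on[of "{p..q}" D D'] assms(2) that
      by (intro continuous_intros) (auto intro: continuous_on_subset)
    fix s assume s: "x < s" "s < y"
    then have "s \<in> {p<..<q}" using that by auto
    then have "(D has_real_derivative D' s) (at s)"
      using assms(2)[of s] by (auto simp: at_within_Icc_at)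
    then have "((\<lambda>s. D s * exp (- K * s)) has_real_derivative (D' s - K * D s) * exp (- K * s)) (at s)"
      by (auto intro!: derivative_eq_intros simp: algebra_simps)
    moreover have "(D' s - K * D s) * exp (- K * s) \<le> 0"
      using assms(3)[of s] \<open>s \<in> {p<..<q}\<close> by (auto simp: mult_le_0_iff abs_le_iff)
    ultimately show "\<exists>y. ((\<lambda>s. D s * exp (- K * s)) has_real_derivative y) (at s) \<and> y \<le> 0"
      by blast
  qed
  have down: "D x * exp (K * x) \<le> D y * exp (K * y)" if "x \<le> y" "{x..y} \<subseteq> {p..q}" for x y
  proof (rule DERIV_nonneg_imp_increasing_open[OF that(1)])
    show "continuous_on {x..y} (\<lambda>s. D s * exp (K * s))"
      using DERIV_continuous_on[of "{p..q}" D D'] assms(2) that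
      by (intro continuous_intros) (auto intro: continuous_on_subset)
    fix s assume s: "x < s" "s < y"
    then have "s \<in> {p<..<q}" using that by auto
    then have "(D has_real_derivative D' s) (at s)"
      using assms(2)[of s] by (auto simp: at_within_Icc_at)
    then have "((\<lambda>s. D s * exp (K * s)) has_real_derivative (D' s + K * D s) * exp (K * s)) (at s)"
      by (auto intro!: derivative_eq_intros simp: algebra_simps)
    moreover have "(D' s + K * D s) * exp (K * s) \<ge> 0"
      using assms(3)[of s] \<open>s \<in> {p<..<q}\<close> by (auto simp: abs_le_iff)
    ultimately show "\<exists>y. ((\<lambda>s. D s * exp (K * s)) has_real_derivative y) (at s) \<and> 0 \<le> y"
      by blast
  qed
  have "D s \<le> 0"
    using up[of c s] down[of s c] assms(5-7)
    by (cases "c \<le> s") (auto simp: mult_le_0_iff)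
  then show ?thesis using assms(4,7) by force
qed

text \<open>The left side is the derivative of \<open>x\<^sup>2 + y\<^sup>2\<close> along the linear
  system x' = A x + B y, y' = C x + E y; the mixed terms are absorbed by |x y| \<le> x^2 +
  y^2.\<close>

lemma linear_system_norm_derivative_bound:
  fixes x y :: real
  shows "\<bar>2 * x * (A * x + B * y) + 2 * y * (C * x + E * y)\<bar>
           \<le> 2 * (\<bar>A\<bar> + \<bar>B\<bar> + \<bar>C\<bar> + \<bar>E\<bar>) * (x\<^sup>2 + y\<^sup>2)"
proof -
  have xy: "\<bar>x * y\<bar> \<le> x\<^sup>2 + y\<^sup>2"
    using sum_squares_bound[of x y] sum_squares_bound[of x "- y"] by (auto simp: abs_if) 
  have "2 * x * (A * x + B * y) + 2 * y * (C * x + E * y)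
          = 2 * (A * x\<^sup>2 + B * (x * y) + C * (x * y) + E * y\<^sup>2)"
    by (simp add: power2_eq_square algebra_simps)
  also have "\<bar>\<dots>\<bar> \<le> 2 * (\<bar>A * x\<^sup>2\<bar> + \<bar>B * (x * y)\<bar> + \<bar>C * (x * y)\<bar> + \<bar>E * y\<^sup>2\<bar>)"
    using abs_triangle_ineq[of "A * x\<^sup>2 + B * (x * y) + C * (x * y)" "E * y\<^sup>2"]
      abs_triangle_ineq[of "A * x\<^sup>2 + B * (x * y)" "C * (x * y)"]
      abs_triangle_ineq[of "A * x\<^sup>2" "B * (x * y)"]
    unfolding abs_mult[of 2] abs_numeral by (intro mult_left_mono) linarith+
  also have "\<dots> \<le> 2 * (\<bar>A\<bar> * (x\<^sup>2 + y\<^sup>2) + \<bar>B\<bar> * (x\<^sup>2 + y\<^sup>2) + \<bar>C\<bar> * (x\<^sup>2 + y\<^sup>2) + \<bar>E\<bar> * (x\<^sup>2 + y\<^sup>2))"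
    using xy unfolding abs_mult
    by (intro mult_left_mono add_mono) (auto simp: abs_mult)
  finally show ?thesis by (simp add: algebra_simps)
qed

text \<open>The difference of two solutions satisfies a linear system whose coefficients are
  continuous, hence bounded, on the compact interval. The squared distance \<open>D\<close> then
  satisfies the Gronwall hypothesis.\<close>

lemma solves_system_unique:
  assumes X: "solves_system l X A {p..q}" and Y: "solves_system l Y B {p..q}"
    and "0 < p" and c: "c \<in> {p..q}" "X c = Y c" "A c = B c" and s: "s \<in> {p..q}"
  shows "X s = Y s" "A s = B s"
proof -
  \<comment> \<open>The coefficients come from splitting the cubic terms: X^2 A - Y^2 B = B (X + Y)
    (X - Y) + X^2 (A - B) and X A^2 - Y B^2 = B^2 (X - Y) + X (A + B) (A - B).\<close>
  define k1 where "k1 s = (- 2 * l - 4 * B s * (X s + Y s)) / (2 * s)" for s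
  define k2 where "k2 s = (1 - 4 * (X s)\<^sup>2) / (2 * s)" for s
  define k3 where "k3 s = - 2 * s + 2 * (B s)\<^sup>2 / s" for s
  define k4 where "k4 s = l / s + 2 * X s * (A s + B s) / s" for s
  define k where "k s = 2 * (\<bar>k1 s\<bar> + \<bar>k2 s\<bar> + \<bar>k3 s\<bar> + \<bar>k4 s\<bar>)" for s
  define D where "D s = (X s - Y s)\<^sup>2 + (A s - B s)\<^sup>2" for s
  define D' where "D' s = 2 * (X s - Y s) * (k1 s * (X s - Y s) + k2 s * (A s - B s))
     + 2 * (A s - B s) * (k3 s * (X s - Y s) + k4 s * (A s - B s))" for s
  have "continuous_on {p..q} k"
    unfolding k_def k1_def k2_def k3_def k4_def
    using \<open>0 < p\<close> by (intro continuous_intros solves_system_continuous[OF X] solves_system_continuous[OF Y]) auto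
  then have "bounded (k ` {p..q})"
    by (intro compact_imp_bounded compact_continuous_image) auto
  then obtain K where K: "\<And>s. s \<in> {p..q} \<Longrightarrow> k s \<le> K"
    unfolding bounded_iff by (metis abs_le_D1 imageI real_norm_def)
  have D: "(D has_real_derivative D' s) (at s within {p..q})" if s: "s \<in> {p..q}" for s
  proof -
    have "s \<noteq> 0" using s \<open>0 < p\<close> by auto
    have 1: "(A s - 2 * X s * (l + 2 * X s * A s)) / (2 * s) - (B s - 2 * Y s * (l + 2 * Y s * B s)) / (2 * s)
           = k1 s * (X s - Y s) + k2 s * (A s - B s)"
      using \<open>s \<noteq> 0\<close> unfolding k1_def k2_def by (simp add: field_simps power2_eq_square)
    have 2: "(- 2 * s * X s + A s / s * (l + 2 * X s * A s)) - (- 2 * s * Y s + B s / s * (l + 2 * Y s * B s))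
           = k3 s * (X s - Y s) + k4 s * (A s - B s)"
      using \<open>s \<noteq> 0\<close> unfolding k3_def k4_def by (simp add: field_simps power2_eq_square)
    have "((\<lambda>s. (X s - Y s)\<^sup>2 + (A s - B s)\<^sup>2) has_real_derivative
             2 * (X s - Y s) * (X' - Y') + 2 * (A s - B s) * (A' - B')) (at s within {p..q})"
      if "(X has_real_derivative X') (at s within {p..q})" "(Y has_real_derivative Y') (at s within {p..q})"
         "(A has_real_derivative A') (at s within {p..q})" "(B has_real_derivative B') (at s within {p..q})"
      for X' Y' A' B'
      using that by (auto intro!: derivative_eq_intros simp: algebra_simps)
    from this[OF solves_systemD(1)[OF X s] solves_systemD(1)[OF Y s]
                 solves_systemD(2)[OF X s] solves_systemD(2)[OF Y s]]
    show ?thesis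
      unfolding D_def D'_def 1 2 .
  qed
  have bd: "\<bar>D' s\<bar> \<le> K * D s" if s: "s \<in> {p..q}" for s
  proof -
    have "\<bar>D' s\<bar> \<le> k s * D s"
      unfolding D'_def k_def D_def by (rule linear_system_norm_derivative_bound)
    also have "\<dots> \<le> K * D s" using K[OF s] by (intro mult_right_mono) (auto simp: D_def)
    finally show ?thesis .
  qed
  have "D s = 0"
    by (rule zero_of_self_bounded_derivative[of p q D D' K c]) (use D bd c s in \<open>auto simp: D_def\<close>)
  then show "X s = Y s" "A s = B s"
    by (auto simp: D_def add_nonneg_eq_0_iff)
qed


section \<open>Holomorphic continuation from a real segment\<close>

text \<open>Identity theorem: the segment accumulates at its midpoint, which lies in the
  ball.\<close>

lemma holomorphic_eq_of_real_segment:
  fixes f g :: "complex \<Rightarrow> complex"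
  assumes "f holomorphic_on ball (of_real t) r" "g holomorphic_on ball (of_real t) r"
    and "p < q" "{p<..<q} \<subseteq> {t - r<..<t + r}"
    and "\<And>s. s \<in> {p<..<q} \<Longrightarrow> f (of_real s) = g (of_real s)"
    and "z \<in> ball (of_real t) r"
  shows "f z = g z"
proof -
  define m where "m = (p + q) / 2"
  have in_ball: "of_real s \<in> ball (complex_of_real t) r" if "s \<in> {p<..<q}" for s
    using assms(4) that by (force simp: dist_of_real dist_real_def abs_less_iff)
  have "m \<in> {p<..<q}" using \<open>p < q\<close> by (auto simp: m_def)
  have lim: "complex_of_real m islimpt of_real ` {p<..<q}"
    unfolding islimpt_approachable
  proof (intro allI impI)
    fix e :: real assume "e > 0"
    \<comment> \<open>The first bound keeps \<open>s\<close> within distance \<open>e\<close> of the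
      midpoint, the second keeps it inside the segment.\<close>
    define s where "s = m + min (e / 2) ((q - p) / 4)"
    have "s \<in> {p<..<q}" "s \<noteq> m" "\<bar>s - m\<bar> < e"
      using \<open>e > 0\<close> \<open>p < q\<close> by (auto simp: s_def m_def field_simps min_def)
    then show "\<exists>x'\<in>complex_of_real ` {p<..<q}. x' \<noteq> of_real m \<and> dist x' (of_real m) < e"
      by (auto simp: dist_of_real dist_real_def intro!: bexI[of _ s])
  qed
  have "f z - g z = 0"
    by (rule analytic_continuation[of "\<lambda>z. f z - g z" "ball (of_real t) r" "of_real ` {p<..<q}" "of_real m"])
       (use assms lim in_ball \<open>m \<in> _\<close> in \<open>auto intro!: holomorphic_intros simp del: mem_ball\<close>)
  then show ?thesis by simp
qed

text \<open>Schwarz reflection: the ball is symmetric about the real axis, and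
  \<open>cnj \<circ> f \<circ> cnj\<close> agrees with \<open>f\<close> on the segment, hence on the
  whole ball.\<close>

lemma holomorphic_real_of_real_segment:
  fixes f :: "complex \<Rightarrow> complex"
  assumes f: "f holomorphic_on ball (of_real t) r"
    and "p < q" "{p<..<q} \<subseteq> {t - r<..<t + r}"
    and real: "\<And>s. s \<in> {p<..<q} \<Longrightarrow> f (of_real s) \<in> \<real>"
    and "s \<in> {t - r<..<t + r}"
  shows "f (of_real s) \<in> \<real>"
proof -
  have img: "cnj ` ball (of_real t) r = ball (of_real t) r"
  proof -
    have "dist (of_real t) (cnj z) = dist (of_real t) z" for z
      by (metis complex_cnj_complex_of_real complex_cnj_diff complex_mod_cnj dist_norm)
    then show ?thesis by (auto simp: image_cnj_conv_vimage_cnj)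
  qed
  have "(cnj \<circ> f \<circ> cnj) (of_real s) = f (of_real s)"
  proof (rule holomorphic_eq_of_real_segment[of _ t r f p q])
    show "cnj \<circ> f \<circ> cnj holomorphic_on ball (complex_of_real t) r"
      by (rule holomorphic_on_compose_cnj_cnj) (use f in \<open>auto simp: img\<close>)
    show "of_real s \<in> ball (complex_of_real t) r"
      using assms(5) by (auto simp: dist_of_real dist_real_def abs_less_iff)
  qed (use assms in \<open>auto simp: Reals_cnj_iff\<close>)
  then show ?thesis by (simp add: Reals_cnj_iff)
qed

text \<open>Both numbers are vector derivatives of the same curve along \<open>S\<close>, and these
  are unique because \<open>t\<close> is a limit point of \<open>S\<close>. A general
  \<open>S\<close> allows one-sided derivatives at an endpoint.\<close>

lemma field_derivative_of_real_eq:
  assumes f: "(f has_field_derivative D) (at (of_real t))"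
    and y: "(y has_real_derivative d) (at t within S)"
    and "at t within S \<noteq> bot" "t \<in> S"
    and eq: "\<And>s. s \<in> S \<Longrightarrow> f (of_real s) = of_real (y s)"
  shows "D = complex_of_real d"
proof (rule vector_derivative_unique_within)
  show "((\<lambda>s. f (of_real s)) has_vector_derivative D) (at t within S)"
    by (rule has_vector_derivative_real_field) fact
  have "((\<lambda>s. complex_of_real (y s)) has_vector_derivative of_real d) (at t within S)"
    using y by (intro has_vector_derivative_of_real) (simp add: has_real_derivative_iff_has_vector_derivative)
  then show "((\<lambda>s. f (of_real s)) has_vector_derivative of_real d) (at t within S)"
    by (rule has_vector_derivative_transform[rotated 2]) (use assms in auto)
qed fact

lemma has_real_derivative_Re_of_real:
  assumes "(F has_field_derivative D) (at (of_real s))"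
  shows "((\<lambda>x. Re (F (of_real x))) has_real_derivative Re D) (at s)"
proof -
  have "((\<lambda>x. F (of_real x)) has_vector_derivative D) (at s)"
    by (rule has_vector_derivative_real_field) fact
  then have "((\<lambda>x. Re (F (of_real x))) has_vector_derivative Re D) (at s)"
    by (rule bounded_linear.has_vector_derivative[OF bounded_linear_Re])
  then show ?thesis by (simp add: has_real_derivative_iff_has_vector_derivative)
qed

text \<open>A linear equation y' = g y is solved by c exp(G) with G a primitive of \<open>g\<close>,
  which exists on the whole ball and never vanishes. This is the only source of continuation; the
  nonlinear system is always reduced to it.\<close>

lemma linear_ODE_continuation:
  fixes g :: "complex \<Rightarrow> complex" and y d :: "real \<Rightarrow> real"
  assumes g: "g holomorphic_on ball (of_real t) r"
    and "p < q" "{p<..<q} \<subseteq> {t - r<..<t + r}"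
    and y: "\<And>s. s \<in> {p<..<q} \<Longrightarrow> (y has_real_derivative d s) (at s within {p<..<q})"
    and ode: "\<And>s. s \<in> {p<..<q} \<Longrightarrow> of_real (d s) = g (of_real s) * of_real (y s)"
    and nz: "\<And>s. s \<in> {p<..<q} \<Longrightarrow> y s \<noteq> 0"
  obtains Y where "Y holomorphic_on ball (of_real t) r"
    and "\<And>z. z \<in> ball (of_real t) r \<Longrightarrow> Y z \<noteq> 0"
    and "\<And>s. s \<in> {p<..<q} \<Longrightarrow> Y (of_real s) = of_real (y s)"
proof -
  obtain G where "\<And>z. z \<in> ball (complex_of_real t) r \<Longrightarrow>
      (G has_field_derivative g z) (at z within ball (of_real t) r)"
    using holomorphic_convex_primitive'[of "ball (complex_of_real t) r" g] g by auto
  then have G: "(G has_field_derivative g z) (at z)" if "z \<in> ball (of_real t) r" for z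
    using that by (metis at_within_open open_ball)
  \<comment> \<open>The quotient of \<open>y\<close> by the candidate solution exp(G): its
    derivative vanishes, and its constant value is the required factor.\<close>
  define h where "h s = complex_of_real (y s) * exp (- G (of_real s))" for s
  have "(h has_vector_derivative 0) (at s within {p<..<q})" if s: "s \<in> {p<..<q}" for s
  proof -
    have sb: "of_real s \<in> ball (complex_of_real t) r"
      using assms(3) s by (force simp: dist_of_real dist_real_def abs_less_iff)
    have "((\<lambda>z. exp (- G z)) has_field_derivative - (g (of_real s) * exp (- G (of_real s)))) (at (of_real s))"
      using G[OF sb] by (auto intro!: derivative_eq_intros)
    then have 1: "((\<lambda>x. exp (- G (of_real x))) has_vector_derivative - (g (of_real s) * exp (- G (of_real s)))) (at s within {p<..<q})"
      by (rule has_vector_derivative_real_field)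
    have "((\<lambda>s. complex_of_real (y s)) has_vector_derivative of_real (d s)) (at s within {p<..<q})"
      using y[OF s] by (intro has_vector_derivative_of_real) (simp add: has_real_derivative_iff_has_vector_derivative)
    from has_vector_derivative_mult[OF this 1] show ?thesis
      unfolding h_def by (simp add: ode[OF s] algebra_simps)
  qed
  then obtain c where c: "\<And>s. s \<in> {p<..<q} \<Longrightarrow> h s = c"
    using has_vector_derivative_zero_constant[of "{p<..<q}" h] by auto
  show thesis
  proof
    show "(\<lambda>z. c * exp (G z)) holomorphic_on ball (of_real t) r"
      using G by (intro holomorphic_intros) (meson holomorphic_on_open open_ball)
    have "(p + q) / 2 \<in> {p<..<q}" using \<open>p < q\<close> by auto
    from c[OF this] nz[OF this] have "c \<noteq> 0" by (auto simp: h_def)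
    then show "c * exp (G z) \<noteq> 0" for z by simp
    show "c * exp (G (of_real s)) = of_real (y s)" if "s \<in> {p<..<q}" for s
      using c[OF that, symmetric] by (simp add: h_def exp_minus)
  qed
qed

text \<open>The right-hand sides are polynomial in the unknowns and singular only at 0, which
  \<open>r \<le> t\<close> keeps outside the ball. The identity theorem carries both equations to
  the ball, and reflection makes the values real on the axis, so taking \<open>Re\<close> loses
  nothing.\<close>

lemma solves_system_continuation:
  assumes X: "X holomorphic_on ball (of_real t) r" and A: "A holomorphic_on ball (of_real t) r"
    and "r \<le> t" "p < q" "{p<..<q} \<subseteq> {t - r<..<t + r}"
    and sol: "solves_system l chi a {p<..<q}"
    and Xball: "\<forall>s\<in>{p<..<q}. X (of_real s) = of_real (chi s)"
    and Aball: "\<forall>s\<in>{p<..<q}. A (of_real s) = of_real (a s)"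
  shows "\<And>s. s \<in> {t - r<..<t + r} \<Longrightarrow> of_real (Re (X (of_real s))) = X (of_real s)"
    and "\<And>s. s \<in> {t - r<..<t + r} \<Longrightarrow> of_real (Re (A (of_real s))) = A (of_real s)"
    and "solves_system l (\<lambda>s. Re (X (of_real s))) (\<lambda>s. Re (A (of_real s))) {t - r<..<t + r}"
proof -
  let ?B = "ball (complex_of_real t) r"
  note Xeq = bspec[OF Xball] and Aeq = bspec[OF Aball]
  have in_ball: "of_real s \<in> ?B" if "s \<in> {t - r<..<t + r}" for s
    using that by (force simp: dist_of_real dist_real_def abs_less_iff)
  show Xre: "of_real (Re (X (of_real s))) = X (of_real s)" if "s \<in> {t - r<..<t + r}" for s
    using holomorphic_real_of_real_segment[OF X assms(4,5) _ that] Xeq by (simp add: of_real_Re)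
  show Are: "of_real (Re (A (of_real s))) = A (of_real s)" if "s \<in> {t - r<..<t + r}" for s
    using holomorphic_real_of_real_segment[OF A assms(4,5) _ that] Aeq by (simp add: of_real_Re)
  have nz: "z \<noteq> 0" if "z \<in> ?B" for z
    using that \<open>r \<le> t\<close> by (auto simp: dist_norm)
  have dX: "(X has_field_derivative deriv X z) (at z)" and dA: "(A has_field_derivative deriv A z) (at z)"
    if "z \<in> ?B" for z using that X A by (auto intro: holomorphic_derivI)
  define FX where "FX z = (A z - 2 * X z * (of_real l + 2 * X z * A z)) / (2 * z)" for z
  define FA where "FA z = - 2 * z * X z + A z / z * (of_real l + 2 * X z * A z)" for z
  have seg: "deriv X (of_real s) = FX (of_real s)" "deriv A (of_real s) = FA (of_real s)"
    if s: "s \<in> {p<..<q}" for s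
  proof -
    have sb: "of_real s \<in> ?B" using in_ball s assms(5) by blast
    have nb: "at s within {p<..<q} \<noteq> bot" using at_within_open[OF s] by simp
    have "deriv X (of_real s) = of_real ((a s - 2 * chi s * (l + 2 * chi s * a s)) / (2 * s))"
      by (rule field_derivative_of_real_eq[OF dX[OF sb] solves_systemD(1)[OF sol s] nb s Xeq])
    then show "deriv X (of_real s) = FX (of_real s)" by (simp add: FX_def Xeq[OF s] Aeq[OF s])
    have "deriv A (of_real s) = of_real (- 2 * s * chi s + a s / s * (l + 2 * chi s * a s))"
      by (rule field_derivative_of_real_eq[OF dA[OF sb] solves_systemD(2)[OF sol s] nb s Aeq])
    then show "deriv A (of_real s) = FA (of_real s)" by (simp add: FA_def Xeq[OF s] Aeq[OF s])
  qed
  have nz2: "2 * z \<noteq> 0" if "z \<in> ?B" for z using nz[OF that] by simp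
  have hF: "FX holomorphic_on ?B" "FA holomorphic_on ?B"
    unfolding FX_def[abs_def] FA_def[abs_def] by (intro holomorphic_intros X A nz nz2; assumption)+
  have eX: "deriv X z = FX z" if "z \<in> ?B" for z
    by (rule holomorphic_eq_of_real_segment[OF holomorphic_deriv[OF X open_ball] hF(1) assms(4,5) seg(1) that])
  have eA: "deriv A z = FA z" if "z \<in> ?B" for z
    by (rule holomorphic_eq_of_real_segment[OF holomorphic_deriv[OF A open_ball] hF(2) assms(4,5) seg(2) that])
  show "solves_system l (\<lambda>s. Re (X (of_real s))) (\<lambda>s. Re (A (of_real s))) {t - r<..<t + r}"
    unfolding solves_system_def
  proof (intro ballI)
    fix s assume s: "s \<in> {t - r<..<t + r}"
    let ?x = "Re (X (of_real s))" and ?a = "Re (A (of_real s))"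
    have "FX (of_real s) = of_real ((?a - 2 * ?x * (l + 2 * ?x * ?a)) / (2 * s))"
      by (simp add: FX_def Xre[OF s] Are[OF s])
    moreover have "FA (of_real s) = of_real (- 2 * s * ?x + ?a / s * (l + 2 * ?x * ?a))"
      by (simp add: FA_def Xre[OF s] Are[OF s])
    ultimately have "Re (deriv X (of_real s)) = (?a - 2 * ?x * (l + 2 * ?x * ?a)) / (2 * s)"
        "Re (deriv A (of_real s)) = - 2 * s * ?x + ?a / s * (l + 2 * ?x * ?a)"
      unfolding eX[OF in_ball[OF s]] eA[OF in_ball[OF s]] by (metis Re_complex_of_real)+
    then show "((\<lambda>s. Re (X (of_real s))) has_real_derivative
           (?a - 2 * ?x * (l + 2 * ?x * ?a)) / (2 * s)) (at s within {t - r<..<t + r}) \<and>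
          ((\<lambda>s. Re (A (of_real s))) has_real_derivative
           - 2 * s * ?x + ?a / s * (l + 2 * ?x * ?a)) (at s within {t - r<..<t + r})"
      using has_real_derivative_Re_of_real[OF dX[OF in_ball[OF s]]]
            has_real_derivative_Re_of_real[OF dA[OF in_ball[OF s]]]
      by (metis has_field_derivative_at_within)
  qed
qed

text \<open>A zero of \<open>w\<close> at \<open>c\<close> is simple and shared by \<open>f\<close>,
  so cancelling z - c in both (\<open>f1\<close>, \<open>w1\<close>) leaves a denominator without
  zeros. Applied below, the quotient is the holomorphic continuation of 4 \<chi> a.\<close>

lemma holomorphic_quotient_simple_zero:
  fixes f w :: "complex \<Rightarrow> complex"
  assumes f: "f holomorphic_on ball c r" and w: "w holomorphic_on ball c r" and "r > 0"
    and nz: "\<And>z. z \<in> ball c r \<Longrightarrow> z \<noteq> c \<Longrightarrow> w z \<noteq> 0"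
    and "w c = 0 \<Longrightarrow> f c = 0 \<and> deriv w c \<noteq> 0"
  obtains k where "k holomorphic_on ball c r" "\<And>z. z \<in> ball c r \<Longrightarrow> f z = k z * w z"
proof (cases "w c = 0")
  case False
  then have "w z \<noteq> 0" if "z \<in> ball c r" for z using nz that by blast
  then show thesis
    by (intro that[of "\<lambda>z. f z / w z"] holomorphic_intros f w) auto
next
  case True
  define f1 where "f1 = (\<lambda>z. if z = c then deriv f c else (f z - f c) / (z - c))"
  define w1 where "w1 = (\<lambda>z. if z = c then deriv w c else (w z - w c) / (z - c))"
  have h: "f1 holomorphic_on ball c r" "w1 holomorphic_on ball c r"
    unfolding f1_def w1_def using \<open>r > 0\<close> f w by (intro pole_lemma; simp)+
  have "w1 z \<noteq> 0" if "z \<in> ball c r" for z using nz[OF that] True assms(5) by (auto simp: w1_def)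
  then show thesis
    using True assms(5) nz
    by (intro that[of "\<lambda>z. f1 z / w1 z"] holomorphic_intros h)
       (auto simp: f1_def w1_def)
qed


section \<open>Continuation across regular points and poles\<close>

text \<open>Nonvanishing of \<open>chi\<close> is built in because division by zero yields 0, so the
  quotient would say nothing about \<open>w\<close> at such a point.\<close>

definition traces :: "real \<Rightarrow> (complex \<Rightarrow> complex) \<Rightarrow> (real \<Rightarrow> real) \<Rightarrow> (real \<Rightarrow> real) \<Rightarrow> real set \<Rightarrow> bool" where
  "traces l w chi a I \<longleftrightarrow> solves_system l chi a I \<and>
     (\<forall>s\<in>I. chi s \<noteq> 0 \<and> w (of_real s) = of_real (a s / (2 * s * chi s)))"

lemma traces_subset: "traces l w chi a I \<Longrightarrow> K \<subseteq> I \<Longrightarrow> traces l w chi a K"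
  unfolding traces_def using solves_system_subset by blast

text \<open>The product \<open>chi s * a s\<close> is deliberately left in this Riccati-type
  equation: it enters linearly, so it can be recovered from \<open>w\<close> and its derivative
  wherever \<open>w\<close> is nonzero.\<close>

lemma quotient_has_real_derivative:
  assumes sol: "solves_system l chi a I" and s: "s \<in> I" "s > 0" "chi s \<noteq> 0"
  defines "W \<equiv> a s / (2 * s * chi s)"
  shows "((\<lambda>s. a s / (2 * s * chi s)) has_real_derivative
            - 1 - W\<^sup>2 + W / s * (2 * l - 1 + 4 * chi s * a s)) (at s within I)"
proof -
  have "((\<lambda>s. a s / (2 * s * chi s)) has_real_derivative
      (A' * (2 * s * chi s) - a s * (2 * (chi s + s * X'))) / (2 * s * chi s)\<^sup>2) (at s within I)"
    if "(chi has_real_derivative X') (at s within I)" "(a has_real_derivative A') (at s within I)" for X' A'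
    using that s by (auto intro!: derivative_eq_intros simp: power2_eq_square)
  from this[OF solves_systemD[OF sol s(1)]] show ?thesis
    by (rule DERIV_cong) (use s in \<open>simp add: W_def field_simps power2_eq_square\<close>)
qed

lemma inverse_quotient_has_real_derivative:
  assumes sol: "solves_system l chi a I" and s: "s \<in> I" "s > 0" "a s \<noteq> 0"
  defines "V \<equiv> 2 * s * chi s / a s"
  shows "((\<lambda>s. 2 * s * chi s / a s) has_real_derivative
            1 + V\<^sup>2 - V / s * (2 * l - 1 + 4 * chi s * a s)) (at s within I)"
proof -
  have "((\<lambda>s. 2 * s * chi s / a s) has_real_derivative
      (2 * (chi s + s * X') * a s - 2 * s * chi s * A') / (a s)\<^sup>2) (at s within I)"
    if "(chi has_real_derivative X') (at s within I)" "(a has_real_derivative A') (at s within I)" for X' A'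
    using that s by (auto intro!: derivative_eq_intros simp: power2_eq_square)
  from this[OF solves_systemD[OF sol s(1)]] show ?thesis
    by (rule DERIV_cong) (use s in \<open>simp add: V_def field_simps power2_eq_square\<close>)
qed

lemma at_within_open_interval_nontrivial:
  fixes s :: real
  assumes "s \<in> {p<..<q}"
  shows "at s within {p<..<q} \<noteq> bot"
  using at_within_open[OF assms] by simp

text \<open>The product \<chi> a is a holomorphic expression in \<open>w\<close> even at a zero with
  derivative -1, so \<chi> satisfies a linear equation with coefficient \<open>g\<close> holomorphic
  on the ball. The data come from a segment left of \<open>t\<close>; the conclusion reaches beyond
  \<open>t\<close>.\<close>

lemma traces_continuation_regular:
  fixes w :: "complex \<Rightarrow> complex"
  assumes w: "w holomorphic_on ball (of_real t) r" and "r > 0" "r \<le> t"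
    and nz: "\<And>z. z \<in> ball (of_real t) r \<Longrightarrow> z \<noteq> of_real t \<Longrightarrow> w z \<noteq> 0"
    and zero: "w (of_real t) = 0 \<Longrightarrow> deriv w (of_real t) = - 1"
    and pq: "p < q" "{p<..<q} \<subseteq> {t - r<..<t}"
    and tr: "traces l w chi a {p<..<q}"
  obtains X A where "traces l w X A {t - r<..<t + r}"
    and "\<And>s. s \<in> {p<..<q} \<Longrightarrow> X s = chi s \<and> A s = a s"
proof -
  let ?B = "ball (complex_of_real t) r"
  have sol: "solves_system l chi a {p<..<q}" and chi_nz: "chi s \<noteq> 0"
    and w_eq: "w (of_real s) = of_real (a s / (2 * s * chi s))" if "s \<in> {p<..<q}" for s
    using tr that by (auto simp: traces_def)
  have pq': "{p<..<q} \<subseteq> {t - r<..<t + r}" by (rule order_trans[OF pq(2)]) (use \<open>r > 0\<close> in auto)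
  have in_ball: "of_real s \<in> ?B" if "s \<in> {t - r<..<t + r}" for s
    using that by (force simp: dist_of_real dist_real_def abs_less_iff)
  have z_nz: "z \<noteq> 0" if "z \<in> ?B" for z
    using that \<open>r \<le> t\<close> by (auto simp: dist_norm)
  have pos: "s > 0" "s \<noteq> t" "of_real s \<in> ?B" if "s \<in> {p<..<q}" for s
  proof -
    have "s \<in> {t - r<..<t}" using that pq(2) by blast
    then show "s > 0" "s \<noteq> t" "of_real s \<in> ?B"
      using in_ball[of s] \<open>r > 0\<close> \<open>r \<le> t\<close> by auto
  qed
  \<comment> \<open>The Riccati-type equation solved for 4 \<chi> a w, so that \<open>f\<close>
    equals this product on the segment.\<close>
  define f where "f z = z * (deriv w z + 1 + (w z)\<^sup>2) + (1 - 2 * of_real l) * w z" for z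
  have dw: "deriv w holomorphic_on ?B" by (rule holomorphic_deriv[OF w open_ball])
  have f: "f holomorphic_on ?B"
    unfolding f_def[abs_def] by (intro holomorphic_on_add holomorphic_on_mult holomorphic_on_diff
      holomorphic_on_power holomorphic_on_const holomorphic_on_ident w dw)
  \<comment> \<open>At a zero of \<open>w\<close> the derivative -1 both makes \<open>f\<close>
    vanish and makes the zero simple, so the division is legitimate.\<close>
  obtain k where k: "k holomorphic_on ?B" "\<And>z. z \<in> ?B \<Longrightarrow> f z = k z * w z"
    using holomorphic_quotient_simple_zero[OF f w \<open>r > 0\<close>] nz zero
    by (auto simp: f_def)
  define g where "g z = w z - (of_real l + k z / 2) / z" for z
  have g: "g holomorphic_on ?B"
    unfolding g_def[abs_def] by (intro holomorphic_intros w k(1) z_nz) auto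
  have ode: "of_real ((a s - 2 * chi s * (l + 2 * chi s * a s)) / (2 * s)) = g (of_real s) * of_real (chi s)"
    if s: "s \<in> {p<..<q}" for s
  proof -
    note pos = pos[OF s]
    define W where "W = a s / (2 * s * chi s)"
    have "(w has_field_derivative deriv w (of_real s)) (at (of_real s))"
      using w pos(3) by (auto intro: holomorphic_derivI)
    from field_derivative_of_real_eq[OF this quotient_has_real_derivative[OF sol[OF s] s pos(1) chi_nz[OF s]]
           at_within_open_interval_nontrivial[OF s] s w_eq]
    have dw_eq: "deriv w (of_real s) = of_real (- 1 - W\<^sup>2 + W / s * (2 * l - 1 + 4 * chi s * a s))"
      by (simp add: W_def)
    have wW: "w (of_real s) = of_real W" using w_eq[OF s] by (simp add: W_def)
    have "f (of_real s) = of_real (s * (- 1 - W\<^sup>2 + W / s * (2 * l - 1 + 4 * chi s * a s) + 1 + W\<^sup>2) + (1 - 2 * l) * W)"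
      by (simp add: f_def dw_eq wW)
    also have "s * (- 1 - W\<^sup>2 + W / s * (2 * l - 1 + 4 * chi s * a s) + 1 + W\<^sup>2) + (1 - 2 * l) * W
        = 4 * chi s * a s * W" using pos(1) by (simp add: field_simps)
    finally have "k (of_real s) * of_real W = of_real (4 * chi s * a s) * of_real W"
      using k(2)[OF pos(3)] wW by simp
    moreover have "of_real W \<noteq> (0 :: complex)" using nz[OF pos(3)] pos(2) wW by simp
    ultimately have "k (of_real s) = of_real (4 * chi s * a s)" by simp
    then have "g (of_real s) = of_real (W - (l + 4 * chi s * a s / 2) / s)"
      by (simp add: g_def wW)
    moreover have "(a s - 2 * chi s * (l + 2 * chi s * a s)) / (2 * s) = (W - (l + 4 * chi s * a s / 2) / s) * chi s"
      using pos(1) chi_nz[OF s] by (simp add: W_def field_simps)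
    ultimately show ?thesis by (simp only: of_real_mult)
  qed
  have "(p + q) / 2 \<in> {p<..<q}" using pq by auto
  note sol' = sol[OF this]
  obtain X where X: "X holomorphic_on ?B" "\<And>z. z \<in> ?B \<Longrightarrow> X z \<noteq> 0"
      "\<And>s. s \<in> {p<..<q} \<Longrightarrow> X (of_real s) = of_real (chi s)"
    using linear_ODE_continuation[OF g pq(1) pq' solves_systemD(1)[OF sol'] ode chi_nz] by blast
  \<comment> \<open>Forced by w = A / (2 z X). Since \<open>X\<close> has no zeros, the relation
    then holds on the whole ball, including at \<open>t\<close>.\<close>
  define A where "A z = 2 * z * X z * w z" for z
  have A: "A holomorphic_on ?B"
    unfolding A_def[abs_def] by (intro holomorphic_intros X w)
  have A_eq: "A (of_real s) = of_real (a s)" if "s \<in> {p<..<q}" for s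
    using pos[OF that] chi_nz[OF that] by (simp add: A_def X(3)[OF that] w_eq[OF that])
  have "\<forall>s\<in>{p<..<q}. X (of_real s) = of_real (chi s)" "\<forall>s\<in>{p<..<q}. A (of_real s) = of_real (a s)"
    using X(3) A_eq by auto
  note cont = solves_system_continuation[OF X(1) A \<open>r \<le> t\<close> pq(1) pq' sol' this]
  show thesis
  proof
    show "traces l w (\<lambda>s. Re (X (of_real s))) (\<lambda>s. Re (A (of_real s))) {t - r<..<t + r}"
      unfolding traces_def
    proof (intro conjI ballI)
      fix s assume s: "s \<in> {t - r<..<t + r}"
      show "Re (X (of_real s)) \<noteq> 0" using cont(1)[OF s] X(2)[OF in_ball[OF s]] by force
      have "w (of_real s) = A (of_real s) / (2 * of_real s * X (of_real s))"
        using X(2)[OF in_ball[OF s]] z_nz[OF in_ball[OF s]] by (simp add: A_def)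
      then show "w (of_real s) = of_real (Re (A (of_real s)) / (2 * s * Re (X (of_real s))))"
        using cont(1,2)[OF s] by simp
    qed (rule cont(3))
    show "Re (X (of_real s)) = chi s \<and> Re (A (of_real s)) = a s" if "s \<in> {p<..<q}" for s
      using X(3) A_eq that by simp
  qed
qed

text \<open>The roles are exchanged: with \<open>v\<close> the reciprocal of \<open>w\<close>, it is
  a that satisfies a linear equation with holomorphic coefficient and stays nonzero. Then \<chi> = a
  v / (2 s) inherits the zero of \<open>v\<close> at \<open>t\<close> and has no other on the
  ball.\<close>

lemma traces_continuation_pole:
  fixes v w :: "complex \<Rightarrow> complex"
  assumes v: "v holomorphic_on ball (of_real t) r" and "r > 0" "r \<le> t"
    and v_inv: "\<And>z. z \<in> ball (of_real t) r \<Longrightarrow> z \<noteq> of_real t \<Longrightarrow> v z \<noteq> 0 \<and> w z = inverse (v z)"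
    and zero: "v (of_real t) = 0" "deriv v (of_real t) = 1"
    and pq: "p < q" "{p<..<q} \<subseteq> {t - r<..<t}"
    and tr: "traces l w chi a {p<..<q}"
  obtains X A where "solves_system l X A {t - r<..<t + r}" "X t = 0"
    and "\<And>s. s \<in> {t - r<..<t} \<Longrightarrow> X s \<noteq> 0"
    and "\<And>s. s \<in> {p<..<q} \<Longrightarrow> X s = chi s \<and> A s = a s"
proof -
  let ?B = "ball (complex_of_real t) r"
  have pq': "{p<..<q} \<subseteq> {t - r<..<t + r}" by (rule order_trans[OF pq(2)]) (use \<open>r > 0\<close> in auto)
  have in_ball: "of_real s \<in> ?B" if "s \<in> {t - r<..<t + r}" for s
    using that by (force simp: dist_of_real dist_real_def abs_less_iff)
  have z_nz: "z \<noteq> 0" if "z \<in> ?B" for z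
    using that \<open>r \<le> t\<close> by (auto simp: dist_norm)
  have pos: "s > 0" "s \<noteq> t" "of_real s \<in> ?B" if "s \<in> {p<..<q}" for s
  proof -
    have "s \<in> {t - r<..<t}" using that pq(2) by blast
    then show "s > 0" "s \<noteq> t" "of_real s \<in> ?B"
      using in_ball[of s] \<open>r > 0\<close> \<open>r \<le> t\<close> by auto
  qed
  have sol: "solves_system l chi a {p<..<q}" using tr by (simp add: traces_def)
  \<comment> \<open>As \<open>v\<close> is nonzero off \<open>t\<close>, so is its inverse, the
    quotient \<open>a s / (2 * s * chi s)\<close>; a zero of \<open>a\<close> is thereby
    excluded.\<close>
  have a_nz: "a s \<noteq> 0" and v_eq: "v (of_real s) = of_real (2 * s * chi s / a s)" if s: "s \<in> {p<..<q}" for s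
  proof -
    have "w (of_real s) = of_real (a s / (2 * s * chi s))" using tr s by (auto simp: traces_def)
    moreover have "v (of_real s) \<noteq> 0" "w (of_real s) = inverse (v (of_real s))"
      using v_inv[OF pos(3)[OF s]] pos(2)[OF s] by auto
    ultimately have "inverse (v (of_real s)) = of_real (a s / (2 * s * chi s))" "v (of_real s) \<noteq> 0" by simp_all
    then have "v (of_real s) = inverse (of_real (a s / (2 * s * chi s)))" "v (of_real s) \<noteq> 0"
      by (metis inverse_inverse_eq)+
    then show "a s \<noteq> 0" "v (of_real s) = of_real (2 * s * chi s / a s)"
      by (auto simp: field_simps)
  qed
  define f where "f z = z * (1 - deriv v z + (v z)\<^sup>2) + (1 - 2 * of_real l) * v z" for z
  have dv: "deriv v holomorphic_on ?B" by (rule holomorphic_deriv[OF v open_ball])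
  have f: "f holomorphic_on ?B"
    unfolding f_def[abs_def] by (intro holomorphic_on_add holomorphic_on_mult holomorphic_on_diff
      holomorphic_on_power holomorphic_on_const holomorphic_on_ident v dv)
  obtain k where k: "k holomorphic_on ?B" "\<And>z. z \<in> ?B \<Longrightarrow> f z = k z * v z"
    using holomorphic_quotient_simple_zero[OF f v \<open>r > 0\<close>] v_inv zero
    by (auto simp: f_def)
  define g where "g z = (of_real l + k z / 2) / z - v z" for z
  have g: "g holomorphic_on ?B"
    unfolding g_def[abs_def] by (intro holomorphic_intros v k(1) z_nz) auto
  have ode: "of_real (- 2 * s * chi s + a s / s * (l + 2 * chi s * a s)) = g (of_real s) * of_real (a s)"
    if s: "s \<in> {p<..<q}" for s
  proof -
    note pos = pos[OF s]
    define V where "V = 2 * s * chi s / a s"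
    have "(v has_field_derivative deriv v (of_real s)) (at (of_real s))"
      using v pos(3) by (auto intro: holomorphic_derivI)
    from field_derivative_of_real_eq[OF this inverse_quotient_has_real_derivative[OF sol s pos(1) a_nz[OF s]]
           at_within_open_interval_nontrivial[OF s] s v_eq]
    have dv_eq: "deriv v (of_real s) = of_real (1 + V\<^sup>2 - V / s * (2 * l - 1 + 4 * chi s * a s))"
      by (simp add: V_def)
    have vV: "v (of_real s) = of_real V" using v_eq[OF s] by (simp add: V_def)
    have "f (of_real s) = of_real (s * (1 - (1 + V\<^sup>2 - V / s * (2 * l - 1 + 4 * chi s * a s)) + V\<^sup>2) + (1 - 2 * l) * V)"
      by (simp add: f_def dv_eq vV)
    also have "s * (1 - (1 + V\<^sup>2 - V / s * (2 * l - 1 + 4 * chi s * a s)) + V\<^sup>2) + (1 - 2 * l) * V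
        = 4 * chi s * a s * V" using pos(1) by (simp add: field_simps)
    finally have "k (of_real s) * of_real V = of_real (4 * chi s * a s) * of_real V"
      using k(2)[OF pos(3)] vV by simp
    moreover have "of_real V \<noteq> (0 :: complex)" using v_inv[OF pos(3)] pos(2) vV by simp
    ultimately have "k (of_real s) = of_real (4 * chi s * a s)" by simp
    then have "g (of_real s) = of_real ((l + 4 * chi s * a s / 2) / s - V)"
      by (simp add: g_def vV)
    moreover have "- 2 * s * chi s + a s / s * (l + 2 * chi s * a s) = ((l + 4 * chi s * a s / 2) / s - V) * a s"
      using pos(1) a_nz[OF s] by (simp add: V_def field_simps)
    ultimately show ?thesis by (simp only: of_real_mult)
  qed
  obtain A where A: "A holomorphic_on ?B" "\<And>z. z \<in> ?B \<Longrightarrow> A z \<noteq> 0"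
      "\<And>s. s \<in> {p<..<q} \<Longrightarrow> A (of_real s) = of_real (a s)"
    using linear_ODE_continuation[OF g pq(1) pq' solves_systemD(2)[OF sol] ode a_nz] by blast
  \<comment> \<open>Forced by v = 2 z X / A, which is legitimate as \<open>A\<close> has no
    zeros.\<close>
  define X where "X z = A z * v z / (2 * z)" for z
  have X: "X holomorphic_on ?B"
    unfolding X_def[abs_def] by (intro holomorphic_intros A v) (use z_nz in auto)
  have X_eq: "X (of_real s) = of_real (chi s)" if "s \<in> {p<..<q}" for s
    using pos[OF that] a_nz[OF that] by (simp add: X_def A(3)[OF that] v_eq[OF that])
  have "\<forall>s\<in>{p<..<q}. X (of_real s) = of_real (chi s)" "\<forall>s\<in>{p<..<q}. A (of_real s) = of_real (a s)"
    using X_eq A(3) by auto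
  note cont = solves_system_continuation[OF X A(1) \<open>r \<le> t\<close> pq(1) pq' sol this]
  show thesis
  proof
    show "solves_system l (\<lambda>s. Re (X (of_real s))) (\<lambda>s. Re (A (of_real s))) {t - r<..<t + r}"
      by (rule cont(3))
    show "Re (X (of_real t)) = 0" by (simp add: X_def zero)
    show "Re (X (of_real s)) \<noteq> 0" if "s \<in> {t - r<..<t}" for s
    proof -
      have s: "s \<in> {t - r<..<t + r}" using that \<open>r > 0\<close> by auto
      have "X (of_real s) \<noteq> 0"
        using A(2)[OF in_ball[OF s]] v_inv[OF in_ball[OF s]] z_nz[OF in_ball[OF s]] that by (simp add: X_def)
      then show ?thesis using cont(1)[OF s] by force
    qed
    show "Re (X (of_real s)) = chi s \<and> Re (A (of_real s)) = a s" if "s \<in> {p<..<q}" for s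
      using A(3) X_eq that by simp
  qed
qed


section \<open>Zeros and poles of Painleve 3 solutions\<close>

lemma meromorphic_P3_solutionD:
  assumes "meromorphic_P3_solution l w" "s > 0" "w analytic_on {of_real s}" "w (of_real s) \<noteq> 0"
  shows "deriv (deriv w) (of_real s) =
          (deriv w (of_real s))\<^sup>2 / w (of_real s) - deriv w (of_real s) / of_real s
            - 2 * of_real l * (w (of_real s))\<^sup>2 / of_real s
          + (2 * of_real l - 2) * (1 / of_real s) + (w (of_real s)) ^ 3 - 1 / w (of_real s)"
  using assms unfolding meromorphic_P3_solution_def by auto

text \<open>Multiplying the Painleve equation by z w clears all denominators. The resulting relation
  \<open>H\<close> = 0 extends to \<open>t\<close> by the identity theorem, where w = 0 reduces it
  to t (1 - w'^2) = 0.\<close>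

lemma P3_deriv_at_zero:
  assumes P3: "meromorphic_P3_solution l w"
    and w: "w holomorphic_on ball (of_real t) r" and "r > 0" "r \<le> t"
    and nz: "\<And>z. z \<in> ball (of_real t) r \<Longrightarrow> z \<noteq> of_real t \<Longrightarrow> w z \<noteq> 0"
    and zero: "w (of_real t) = 0"
  shows "(deriv w (of_real t))\<^sup>2 = 1"
proof -
  let ?B = "ball (complex_of_real t) r"
  have dw: "deriv w holomorphic_on ?B" by (rule holomorphic_deriv[OF w open_ball])
  have ddw: "deriv (deriv w) holomorphic_on ?B" by (rule holomorphic_deriv[OF dw open_ball])
  define H where "H z = z * (w z * deriv (deriv w) z - (deriv w z)\<^sup>2 + 1 - (w z) ^ 4)
      + w z * deriv w z + 2 * of_real l * (w z) ^ 3 - (2 * of_real l - 2) * w z" for z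
  have H: "H holomorphic_on ?B"
    unfolding H_def[abs_def]
    by (intro holomorphic_on_add holomorphic_on_mult holomorphic_on_diff
      holomorphic_on_power holomorphic_on_const holomorphic_on_ident w dw ddw)
  have seg: "H (of_real s) = 0" if s: "s \<in> {t - r<..<t}" for s
  proof -
    have sb: "of_real s \<in> ?B" and "s > 0" "s \<noteq> t"
      using s \<open>r \<le> t\<close> by (auto simp: dist_of_real dist_real_def)
    have "w analytic_on {of_real s}"
      using w sb by (meson analytic_at open_ball)
    moreover have "w (of_real s) \<noteq> 0" using nz[OF sb] \<open>s \<noteq> t\<close> by simp
    ultimately have eq: "deriv (deriv w) (of_real s) =
          (deriv w (of_real s))\<^sup>2 / w (of_real s) - deriv w (of_real s) / of_real s
            - 2 * of_real l * (w (of_real s))\<^sup>2 / of_real s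
          + (2 * of_real l - 2) * (1 / of_real s) + (w (of_real s)) ^ 3 - 1 / w (of_real s)"
      using P3 \<open>s > 0\<close> by (intro meromorphic_P3_solutionD)
    show ?thesis
      using \<open>w (of_real s) \<noteq> 0\<close> \<open>s > 0\<close> unfolding H_def eq
      by (simp add: field_simps power2_eq_square power3_eq_cube power4_eq_xxxx)
  qed
  have "H (of_real t) = 0"
    by (rule holomorphic_eq_of_real_segment[OF H holomorphic_on_const, of "t - r" t])
       (use seg \<open>r > 0\<close> in auto)
  then show ?thesis using zero \<open>r > 0\<close> \<open>r \<le> t\<close> by (simp add: H_def)
qed

text \<open>The reciprocal \<open>v\<close> satisfies an equation of the same shape; cleared of
  denominators it reduces at \<open>t\<close> to t (1 - v'^2) = 0. In particular every pole on the
  positive axis is simple.\<close>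

lemma P3_inverse_deriv_at_zero:
  assumes P3: "meromorphic_P3_solution l w"
    and v: "v holomorphic_on ball (of_real t) r" and "r > 0" "r \<le> t"
    and v_inv: "\<And>z. z \<in> ball (of_real t) r \<Longrightarrow> z \<noteq> of_real t \<Longrightarrow> v z \<noteq> 0 \<and> w z = inverse (v z)"
    and zero: "v (of_real t) = 0"
  shows "(deriv v (of_real t))\<^sup>2 = 1"
proof -
  let ?B = "ball (complex_of_real t) r"
  define U where "U = ?B - {of_real t}"
  have "open U" by (auto simp: U_def)
  have U: "z \<in> ?B" "v z \<noteq> 0" "w z = inverse (v z)" if "z \<in> U" for z
    using that v_inv by (auto simp: U_def)
  have dv: "deriv v holomorphic_on ?B" by (rule holomorphic_deriv[OF v open_ball])
  have ddv: "deriv (deriv v) holomorphic_on ?B" by (rule holomorphic_deriv[OF dv open_ball])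
  have dw: "(w has_field_derivative - deriv v z / (v z)\<^sup>2) (at z)" if z: "z \<in> U" for z
  proof (rule has_field_derivative_transform_within_open[OF _ \<open>open U\<close> z])
    have "(v has_field_derivative deriv v z) (at z)"
      using v U(1)[OF z] by (auto intro: holomorphic_derivI)
    then show "((\<lambda>z. inverse (v z)) has_field_derivative - deriv v z / (v z)\<^sup>2) (at z)"
      using U(2)[OF z] by (auto intro!: derivative_eq_intros simp: field_simps power2_eq_square)
  qed (use U in auto)
  have dw_eq: "deriv w z = - deriv v z / (v z)\<^sup>2" if "z \<in> U" for z
    using dw[OF that] by (rule DERIV_imp_deriv)
  have ddw: "deriv (deriv w) z = - deriv (deriv v) z / (v z)\<^sup>2 + 2 * (deriv v z)\<^sup>2 / (v z) ^ 3" if z: "z \<in> U" for z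
  proof (rule DERIV_imp_deriv, rule has_field_derivative_transform_within_open[OF _ \<open>open U\<close> z])
    have 1: "(v has_field_derivative deriv v z) (at z)" "(deriv v has_field_derivative deriv (deriv v) z) (at z)"
      using v dv U(1)[OF z] by (auto intro: holomorphic_derivI)
    have "((\<lambda>z. - deriv v z / (v z)\<^sup>2) has_field_derivative
         ((- d2) * (v z)\<^sup>2 - (- deriv v z) * (2 * (v z) * d1)) / ((v z)\<^sup>2 * (v z)\<^sup>2)) (at z)"
      if "(v has_field_derivative d1) (at z)" "(deriv v has_field_derivative d2) (at z)" for d1 d2
      using U(2)[OF z] by (auto intro!: derivative_eq_intros that simp: field_simps)
    from this[OF 1] show "((\<lambda>z. - deriv v z / (v z)\<^sup>2) has_field_derivative
         - deriv (deriv v) z / (v z)\<^sup>2 + 2 * (deriv v z)\<^sup>2 / (v z) ^ 3) (at z)"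
      by (rule DERIV_cong) (use U(2)[OF z] in \<open>simp add: field_simps power2_eq_square power3_eq_cube\<close>)
  qed (use dw_eq in auto)
  define H where "H z = z * (v z * deriv (deriv v) z - (deriv v z)\<^sup>2 + 1 - (v z) ^ 4)
      + v z * deriv v z - 2 * of_real l * v z + (2 * of_real l - 2) * (v z) ^ 3" for z
  have H: "H holomorphic_on ?B"
    unfolding H_def[abs_def]
    by (intro holomorphic_on_add holomorphic_on_mult holomorphic_on_diff
      holomorphic_on_power holomorphic_on_const holomorphic_on_ident v dv ddv)
  have seg: "H (of_real s) = 0" if s: "s \<in> {t - r<..<t}" for s
  proof -
    let ?z = "complex_of_real s"
    have "s > 0" and sU: "?z \<in> U"
      using s \<open>r \<le> t\<close> by (auto simp: dist_of_real dist_real_def U_def)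
    have "w analytic_on {?z}"
      using dw sU \<open>open U\<close> by (meson analytic_at holomorphic_on_open)
    moreover have "w ?z \<noteq> 0" using U[OF sU] by simp
    ultimately have eq: "deriv (deriv w) ?z =
          (deriv w ?z)\<^sup>2 / w ?z - deriv w ?z / ?z - 2 * of_real l * (w ?z)\<^sup>2 / ?z
          + (2 * of_real l - 2) * (1 / ?z) + (w ?z) ^ 3 - 1 / w ?z"
      using P3 \<open>s > 0\<close> by (intro meromorphic_P3_solutionD)
    \<comment> \<open>The equation for w = 1/x, with its derivatives written through those of x, is
      multiplied by x^3 z. The letters stand for arbitrary numbers, so only field arithmetic is
      involved.\<close>
    have alg: "z * (x * d2 - d1\<^sup>2 + 1 - x ^ 4) + x * d1 - 2 * m * x + (2 * m - 2) * x ^ 3 = 0"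
      if "- d2 / x\<^sup>2 + 2 * d1\<^sup>2 / x ^ 3 =
        (- d1 / x\<^sup>2)\<^sup>2 / inverse x - (- d1 / x\<^sup>2) / z - 2 * m * (inverse x)\<^sup>2 / z
        + (2 * m - 2) * (1 / z) + (inverse x) ^ 3 - 1 / inverse x" "x \<noteq> 0" "z \<noteq> 0"
      for x z m d1 d2 :: complex
    proof -
      have "x ^ 3 * z * (- d2 / x\<^sup>2 + 2 * d1\<^sup>2 / x ^ 3) = x ^ 3 * z * ((- d1 / x\<^sup>2)\<^sup>2 / inverse x - (- d1 / x\<^sup>2) / z - 2 * m * (inverse x)\<^sup>2 / z
        + (2 * m - 2) * (1 / z) + (inverse x) ^ 3 - 1 / inverse x)"
        using that(1) by simp
      also have "x ^ 3 * z * (- d2 / x\<^sup>2 + 2 * d1\<^sup>2 / x ^ 3) = z * (- x * d2 + 2 * d1\<^sup>2)"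
        using that(2,3) by (simp add: field_simps power2_eq_square power3_eq_cube)
      also have "x ^ 3 * z * ((- d1 / x\<^sup>2)\<^sup>2 / inverse x - (- d1 / x\<^sup>2) / z - 2 * m * (inverse x)\<^sup>2 / z
        + (2 * m - 2) * (1 / z) + (inverse x) ^ 3 - 1 / inverse x)
        = z * d1\<^sup>2 + x * d1 - 2 * m * x + (2 * m - 2) * x ^ 3 + z - z * x ^ 4"
        using that(2,3) by (simp add: field_simps power2_eq_square power3_eq_cube power4_eq_xxxx)
      finally show ?thesis by (simp add: algebra_simps)
    qed
    show ?thesis
      unfolding H_def
      by (rule alg) (use eq[unfolded ddw[OF sU] dw_eq[OF sU] U(3)[OF sU]] U(2)[OF sU] \<open>s > 0\<close> in auto)
  qed
  have "H (of_real t) = 0"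
    by (rule holomorphic_eq_of_real_segment[OF H holomorphic_on_const, of "t - r" t])
       (use seg \<open>r > 0\<close> in auto)
  then show ?thesis using zero \<open>r > 0\<close> \<open>r \<le> t\<close> by (simp add: H_def)
qed

section \<open>Local description of the function near poles and regular points\<close>

lemma pole_inverse_neighbourhood:
  assumes "w meromorphic_on {of_real t}" "is_pole w (of_real t)" "t > 0"
  obtains r v where "0 < r" "r \<le> t" "v holomorphic_on ball (of_real t) r" "v (of_real t) = 0"
    "\<And>z. z \<in> ball (of_real t) r \<Longrightarrow> z \<noteq> of_real t \<Longrightarrow> v z \<noteq> 0 \<and> w z = inverse (v z)"
proof -
  have "isolated_singularity_at w (of_real t)"
    using assms(1) by (simp add: meromorphic_at_iff)
  then obtain r1 where r1: "r1 > 0" "w analytic_on ball (of_real t) r1 - {of_real t}"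
    by (auto simp: isolated_singularity_at_def)
  have "\<forall>\<^sub>F z in at (of_real t). w z \<noteq> 0"
    using assms(2) by (rule non_zero_neighbour_pole)
  then obtain r2 where r2: "r2 > 0" "\<And>z. z \<noteq> of_real t \<Longrightarrow> dist z (of_real t) < r2 \<Longrightarrow> w z \<noteq> 0"
    by (auto simp: eventually_at)
  \<comment> \<open>Small enough for \<open>w\<close> to be analytic and nonzero on the punctured
    ball; the bound by \<open>t\<close> keeps the origin outside.\<close>
  define r where "r = min (min r1 r2) t"
  define v where "v = (\<lambda>z. if z = of_real t then 0 else inverse (w z))"
  have w_nz: "w z \<noteq> 0" if "z \<in> ball (of_real t) r - {of_real t}" for z
    using that r2(2)[of z] by (auto simp: r_def dist_commute)
  show thesis
  proof
    show "v holomorphic_on ball (of_real t) r"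
      unfolding v_def
    proof (rule is_pole_inverse_holomorphic)
      have "w holomorphic_on ball (of_real t) r1 - {of_real t}"
        using r1(2) by (rule analytic_imp_holomorphic)
      then show "w holomorphic_on ball (of_real t) r - {of_real t}"
        by (rule holomorphic_on_subset) (auto simp: r_def)
    qed (use assms w_nz in auto)
  qed (use r1 r2 \<open>t > 0\<close> w_nz in \<open>auto simp: r_def v_def\<close>)
qed

text \<open>Translates between the residue of \<open>w\<close> and the derivative of its reciprocal
  at a simple pole; residue one becomes the condition \<open>deriv v c = 1\<close> used for the
  continuation.\<close>

lemma residue_of_inverse:
  assumes v: "v holomorphic_on ball c r" and "r > 0"
    and v_inv: "\<And>z. z \<in> ball c r \<Longrightarrow> z \<noteq> c \<Longrightarrow> v z \<noteq> 0 \<and> w z = inverse (v z)"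
    and zero: "v c = 0" "deriv v c \<noteq> 0"
  shows "residue w c = 1 / deriv v c"
proof -
  have "residue w c = residue (\<lambda>z. 1 / v z) c"
  proof (rule residue_cong)
    have "\<forall>\<^sub>F z in at c. z \<in> ball c r - {c}"
      by (rule eventually_at_in_open) (use \<open>r > 0\<close> in auto)
    then show "\<forall>\<^sub>F z in at c. w z = 1 / v z"
      by eventually_elim (use v_inv in \<open>auto simp: inverse_eq_divide\<close>)
  qed auto
  also have "\<dots> = 1 / deriv v c"
    by (rule residue_simple_pole_deriv[where s = "ball c r"])
       (use v \<open>r > 0\<close> zero in \<open>auto intro: holomorphic_derivI\<close>)
  finally show ?thesis .
qed

text \<open>Nonzero values arbitrarily close to the left of \<open>t\<close> prevent
  \<open>w\<close> from vanishing identically near \<open>t\<close>, so a zero at \<open>t\<close>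
  is isolated.\<close>

lemma regular_neighbourhood:
  assumes "w analytic_on {of_real t}" "t > 0"
    and "\<And>c. c < t \<Longrightarrow> \<exists>s\<in>{c<..<t}. w (of_real s) \<noteq> 0"
  obtains r where "0 < r" "r \<le> t" "w holomorphic_on ball (of_real t) r"
    "\<And>z. z \<in> ball (of_real t) r \<Longrightarrow> z \<noteq> of_real t \<Longrightarrow> w z \<noteq> 0"
proof -
  obtain r1 where r1: "r1 > 0" "w holomorphic_on ball (of_real t) r1"
    using assms(1) by (auto simp: analytic_on_def)
  obtain s where s: "s \<in> {t - r1<..<t}" "w (of_real s) \<noteq> 0"
    using assms(3)[of "t - r1"] \<open>r1 > 0\<close> by auto
  have sb: "of_real s \<in> ball (complex_of_real t) r1"
    using s(1) by (auto simp: dist_of_real dist_real_def)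
  obtain r2 where r2: "r2 > 0" "\<And>z. z \<in> ball (of_real t) r2 - {of_real t} \<Longrightarrow> w z \<noteq> 0"
  proof (cases "w (of_real t) = 0")
    case True
    show ?thesis
      by (rule isolated_zeros[OF r1(2) open_ball connected_ball _ True sb s(2)])
         (use r1(1) that in auto)
  next
    case False
    have "isCont w (of_real t)" using assms(1) by (rule analytic_at_imp_isCont)
    from continuous_at_avoid[OF this False] that show ?thesis
      by (metis DiffD1 dist_commute mem_ball)
  qed
  show thesis
  proof (rule that[of "min (min r1 r2) t"])
    show "w holomorphic_on ball (of_real t) (min (min r1 r2) t)"
      using r1(2) by (rule holomorphic_on_subset) auto
  qed (use r1 r2 \<open>t > 0\<close> in auto)
qed

text \<open>If \<open>w\<close> vanished along the interval, so would \<open>a\<close>, and the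
  second equation would force \<chi> = 0, against the trace condition.\<close>

lemma traces_frequently_nonzero:
  assumes tr: "traces l w chi a {c<..<t}" and "0 \<le> c" "c < t"
  shows "\<exists>s\<in>{c<..<t}. w (of_real s) \<noteq> 0"
proof (rule ccontr)
  assume "\<not> ?thesis"
  then have a0: "a s = 0" if "s \<in> {c<..<t}" for s
    using tr that \<open>0 \<le> c\<close> by (fastforce simp: traces_def)
  define s where "s = (c + t) / 2"
  have s: "s \<in> {c<..<t}" using \<open>c < t\<close> by (auto simp: s_def)
  have sol: "solves_system l chi a {c<..<t}" and "chi s \<noteq> 0" using tr s by (auto simp: traces_def)
  have "(a has_real_derivative - 2 * s * chi s) (at s)"
    using solves_systemD(2)[OF sol s] a0[OF s] at_within_open[OF s] by simp
  moreover have "(a has_real_derivative 0) (at s)"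
    by (rule has_field_derivative_transform_within_open[of "\<lambda>_. 0" _ _ "{c<..<t}"]) (use s a0 in auto)
  ultimately have "- 2 * s * chi s = 0" by (rule DERIV_unique)
  then show False using s \<open>0 \<le> c\<close> \<open>chi s \<noteq> 0\<close> by auto
qed

text \<open>The switch point \<open>m\<close> lies in the overlap where both solutions agree, so the
  glued pair coincides with the first solution left of \<open>q\<close> and with the second right of
  \<open>p\<close>; locality finishes.\<close>

lemma solves_system_glue:
  assumes X: "solves_system l X A I" and Y: "solves_system l Y B K"
    and eq: "\<And>s. s \<in> {p<..<q} \<Longrightarrow> Y s = X s \<and> B s = A s" and m: "m \<in> {p<..<q}"
    and sub: "L \<inter> {..<q} \<subseteq> I" "L \<inter> {p<..} \<subseteq> K"
  shows "solves_system l (\<lambda>s. if s < m then X s else Y s) (\<lambda>s. if s < m then A s else B s) L"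
proof (rule solves_system_local)
  fix s assume "s \<in> L"
  show "\<exists>U K chi' a'. open U \<and> s \<in> U \<and> L \<inter> U \<subseteq> K \<and> solves_system l chi' a' K \<and>
      (\<forall>x\<in>L \<inter> U. (if x < m then X x else Y x) = chi' x \<and> (if x < m then A x else B x) = a' x)"
  proof (cases "s < q")
    case True
    show ?thesis
      using True X sub eq m by (intro exI[of _ "{..<q}"] exI[of _ I] exI[of _ X] exI[of _ A]) auto
  next
    case False
    show ?thesis
      using False Y sub eq m by (intro exI[of _ "{p<..}"] exI[of _ K] exI[of _ Y] exI[of _ B]) auto
  qed
qed

section \<open>One-sided limits along the positive axis\<close>

lemma filterlim_of_real_at_left:
  "filterlim complex_of_real (at (of_real t)) (at_left t)"
  by (intro filterlim_atI tendsto_intros) (auto simp: eventually_at_filter)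

text \<open>At a pole \<open>w\<close> tends to infinity along every approach, so one finite
  one-sided limit excludes it. Nice meromorphicity then gives analyticity, and continuity identifies
  the value.\<close>

lemma nicely_meromorphic_left_limit:
  assumes w: "w nicely_meromorphic_on S" "of_real t \<in> S"
    and lim: "((\<lambda>s. w (of_real s)) \<longlongrightarrow> L) (at_left t)"
  shows "w analytic_on {of_real t}" "w (of_real t) = L"
proof -
  have "\<not> is_pole w (of_real t)"
  proof
    assume "is_pole w (of_real t)"
    then have "filterlim (\<lambda>s. w (of_real s)) at_infinity (at_left t)"
      unfolding is_pole_def by (rule filterlim_compose[OF _ filterlim_of_real_at_left])
    then show False
      using lim not_tendsto_and_filterlim_at_infinity[of "at_left t" "\<lambda>s. w (of_real s)" L] by simp
  qed
  then show an: "w analytic_on {of_real t}"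
    using w by (intro nicely_meromorphic_on_imp_analytic_at[OF w])
  then have "(w \<longlongrightarrow> w (of_real t)) (at (of_real t))"
    using analytic_at_imp_isCont isContD by blast
  then have "((\<lambda>s. w (of_real s)) \<longlongrightarrow> w (of_real t)) (at_left t)"
    by (rule filterlim_compose[OF _ filterlim_of_real_at_left])
  then show "w (of_real t) = L"
    using lim by (intro tendsto_unique[of "at_left t"]) auto
qed



section \<open>Existence of the Poincare map\<close>

text \<open>The first equation gives \<chi>' = a / (2 s) \<noteq> 0 at \<open>s0\<close>, so the
  zero of \<chi> there is isolated.\<close>

lemma traces_near_start:
  assumes "a s0 \<noteq> 0" "s0 > 0" "open J" "s0 \<in> J" "J \<subseteq> {0<..}"
    and sol: "solves_system l chi a J" and "chi s0 = 0"
    and w: "\<And>s. s \<in> J \<Longrightarrow> chi s \<noteq> 0 \<Longrightarrow> w (of_real s) = of_real (a s / (2 * s * chi s))"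
  obtains e where "e > 0" "{s0..s0 + e} \<subseteq> J" "traces l w chi a {s0<..s0 + e}"
proof -
  obtain e1 where e1: "e1 > 0" "cball s0 e1 \<subseteq> J"
    using \<open>open J\<close> \<open>s0 \<in> J\<close> open_contains_cball by blast
  have "(chi has_real_derivative a s0 / (2 * s0)) (at s0)"
    using solves_systemD(1)[OF sol \<open>s0 \<in> J\<close>] \<open>chi s0 = 0\<close> at_within_open[OF \<open>s0 \<in> J\<close> \<open>open J\<close>] by simp
  then have "((\<lambda>s. chi s / (s - s0)) \<longlongrightarrow> a s0 / (2 * s0)) (at s0)"
    using \<open>chi s0 = 0\<close> by (simp add: has_field_derivative_iff)
  then have "\<forall>\<^sub>F s in at s0. chi s / (s - s0) \<noteq> 0"
    by (rule tendsto_imp_eventually_ne) (use assms in auto)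
  then obtain e2 where e2: "e2 > 0" "\<And>s. s \<noteq> s0 \<Longrightarrow> dist s s0 < e2 \<Longrightarrow> chi s \<noteq> 0"
    by (auto simp: eventually_at)
  \<comment> \<open>Halving \<open>e2\<close> keeps the closed right end at distance strictly below
    \<open>e2\<close>.\<close>
  define e where "e = min e1 (e2 / 2)"
  show thesis
  proof
    show "e > 0" using e1 e2 by (simp add: e_def)
    have "{s0..s0 + e} \<subseteq> cball s0 e1" by (auto simp: e_def dist_real_def)
    then show sub: "{s0..s0 + e} \<subseteq> J" using e1 by blast
    have "{s0<..s0 + e} \<subseteq> J" using sub by (auto simp: subset_iff)
    moreover have "chi s \<noteq> 0" if "s \<in> {s0<..s0 + e}" for s
      using that e2(1) by (intro e2(2)) (auto simp: e_def dist_real_def)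
    ultimately show "traces l w chi a {s0<..s0 + e}"
      unfolding traces_def using solves_system_subset[OF sol] w by blast
  qed
qed

text \<open>The relation to \<open>w\<close> starts strictly after \<open>s0\<close>, where \<chi>
  vanishes. Existence of such a pair for each \<open>t\<close> takes the place of a single maximal
  solution.\<close>

definition good_solution ::
  "real \<Rightarrow> (complex \<Rightarrow> complex) \<Rightarrow> real \<Rightarrow> real \<Rightarrow> (real \<Rightarrow> real) \<Rightarrow> (real \<Rightarrow> real) \<Rightarrow> real \<Rightarrow> bool" where
  "good_solution l w s0 a0 X A t \<longleftrightarrow>
     solves_system l X A {s0..t} \<and> X s0 = 0 \<and> A s0 = a0 \<and>
     (\<forall>s\<in>{s0<..t}. X s \<noteq> 0 \<and> w (of_real s) = of_real (A s / (2 * s * X s)))"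

lemma good_solution_traces:
  assumes "good_solution l w s0 a0 X A t" "I \<subseteq> {s0<..t}"
  shows "traces l w X A I"
proof -
  have "I \<subseteq> {s0..t}" using assms(2) by auto
  then show ?thesis
    using assms solves_system_subset[of l X A "{s0..t}" I] by (auto simp: good_solution_def traces_def)
qed

lemma good_solution_mono:
  assumes "good_solution l w s0 a0 X A t" "t' \<le> t"
  shows "good_solution l w s0 a0 X A t'"
proof -
  have "{s0..t'} \<subseteq> {s0..t}" "{s0<..t'} \<subseteq> {s0<..t}" using assms(2) by auto
  then show ?thesis
    using assms(1) solves_system_subset[of l X A "{s0..t}" "{s0..t'}"] by (auto simp: good_solution_def)
qed

text \<open>The pairs supplied by \<open>sol\<close> may vary with \<open>t0\<close>; one of them
  reaching close enough to \<open>t\<close> is continued across \<open>t\<close>. A zero at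
  \<open>t\<close> has derivative 1 or -1 by the Painleve equation, and 1 is excluded by
  hypothesis.\<close>

lemma good_solution_extend:
  assumes P3: "meromorphic_P3_solution l w" and "0 < s0" "s0 < t"
    and an: "w analytic_on {of_real t}"
    and zero: "w (of_real t) = 0 \<Longrightarrow> deriv w (of_real t) \<noteq> 1"
    and sol: "\<And>t0. t0 \<in> {s0<..<t} \<Longrightarrow> \<exists>X A. good_solution l w s0 a0 X A t0"
  obtains e where "e > 0" "\<And>t1. t1 < t + e \<Longrightarrow> \<exists>X A. good_solution l w s0 a0 X A t1"
proof -
  have freq: "\<exists>s\<in>{c<..<t}. w (of_real s) \<noteq> 0" if "c < t" for c
  proof -
    \<comment> \<open>Traces exist only to the right of \<open>s0\<close>, so the lower bound
      \<open>c\<close> is raised to at least \<open>s0\<close>.\<close>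
    define t0 where "t0 = (max s0 c + t) / 2"
    have t0: "t0 \<in> {s0<..<t}" "max s0 c < t0" using that \<open>s0 < t\<close> by (auto simp: t0_def)
    obtain X A where "good_solution l w s0 a0 X A t0" using sol[OF t0(1)] by blast
    then have "traces l w X A {max s0 c<..<t0}" by (rule good_solution_traces) auto
    from traces_frequently_nonzero[OF this] t0 \<open>0 < s0\<close> show ?thesis by force
  qed
  obtain r where r: "0 < r" "r \<le> t" "w holomorphic_on ball (of_real t) r"
    and nz: "\<And>z. z \<in> ball (of_real t) r \<Longrightarrow> z \<noteq> of_real t \<Longrightarrow> w z \<noteq> 0"
    using regular_neighbourhood[OF an] \<open>0 < s0\<close> \<open>s0 < t\<close> freq by (metis less_trans)
  have deriv: "deriv w (of_real t) = - 1" if "w (of_real t) = 0"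
    using P3_deriv_at_zero[OF P3 r(3,1,2) nz that] zero[OF that] by (simp add: power2_eq_1_iff)
  \<comment> \<open>Both constraints place the overlap from \<open>p\<close> to \<open>t0\<close> in
    the domain of the old solution and in the ball of continuation.\<close>
  define p where "p = max s0 (t - r)"
  define t0 where "t0 = (p + t) / 2"
  have p: "s0 \<le> p" "t - r \<le> p" "p < t0" "t0 < t"
    using \<open>s0 < t\<close> r by (auto simp: p_def t0_def)
  obtain X A where g: "good_solution l w s0 a0 X A t0" using sol[of t0] p by auto
  then have tr: "traces l w X A {p<..<t0}"
    by (rule good_solution_traces) (use p in auto)
  have sub: "{p<..<t0} \<subseteq> {t - r<..<t}" using p by auto
  obtain Y B where Y: "traces l w Y B {t - r<..<t + r}"
    and eq: "\<And>s. s \<in> {p<..<t0} \<Longrightarrow> Y s = X s \<and> B s = A s"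
    by (rule traces_continuation_regular[OF r(3,1,2) nz deriv p(3) sub tr]) blast+
  define m where "m = (p + t0) / 2"
  have m: "m \<in> {p<..<t0}" using p by (auto simp: m_def)
  show thesis
  proof
    show "r > 0" by fact
    fix t1 assume t1: "t1 < t + r"
    let ?X = "\<lambda>s. if s < m then X s else Y s" and ?A = "\<lambda>s. if s < m then A s else B s"
    have "solves_system l ?X ?A {s0..t1}"
      by (rule solves_system_glue[of _ _ _ "{s0..t0}" _ _ "{t - r<..<t + r}" p t0])
         (use g Y eq m p t1 in \<open>auto simp: good_solution_def traces_def\<close>)
    moreover have "?X s \<noteq> 0 \<and> w (of_real s) = of_real (?A s / (2 * s * ?X s))" if "s \<in> {s0<..t1}" for s
    proof (cases "s < m")
      case True
      then have "s \<in> {s0<..t0}" using that m by auto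
      then show ?thesis using True g by (auto simp: good_solution_def traces_def)
    next
      case False
      then have "s \<in> {t - r<..<t + r}" using that m p t1 by auto
      then show ?thesis using False Y by (auto simp: traces_def)
    qed
    ultimately have "good_solution l w s0 a0 ?X ?A t1"
      using g m p by (simp add: good_solution_def)
    then show "\<exists>X A. good_solution l w s0 a0 X A t1" by blast
  qed
qed

text \<open>Supremum argument: solutions exist up to every time below \<open>T\<close>, and the
  extension lemma carries them past \<open>T\<close>, so \<open>T\<close> can neither be smaller
  than \<open>t\<close> nor be \<open>t\<close> without a solution there.\<close>

lemma good_solution_until:
  assumes P3: "meromorphic_P3_solution l w" and "0 < s0" "s0 < s1"
    and an: "w analytic_on (of_real ` {s0<..<s1})"
    and zero: "\<And>s. s \<in> {s0<..<s1} \<Longrightarrow> w (of_real s) = 0 \<Longrightarrow> deriv w (of_real s) \<noteq> 1"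
    and start: "s0 < t1" "good_solution l w s0 a0 chi a t1"
    and t: "t \<in> {s0<..<s1}"
  shows "\<exists>X A. good_solution l w s0 a0 X A t"
proof (rule ccontr)
  assume neg: "\<not> ?thesis"
  define S where "S = {t0. s0 < t0 \<and> t0 \<le> t \<and> (\<exists>X A. good_solution l w s0 a0 X A t0)}"
  have "min t1 t \<in> S"
    unfolding S_def using start t good_solution_mono[OF start(2), of "min t1 t"] by auto
  moreover have bdd: "bdd_above S" by (auto simp: S_def)
  ultimately have T1: "min t1 t \<le> Sup S" and "Sup S \<le> t"
    by (auto intro!: cSup_upper cSup_least simp: S_def)
  define T where "T = Sup S"
  have T: "s0 < T" "T \<le> t" using T1 start(1) t \<open>Sup S \<le> t\<close> by (auto simp: T_def)
  have below: "\<exists>X A. good_solution l w s0 a0 X A t0" if "t0 \<in> {s0<..<T}" for t0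
  proof -
    have "\<exists>t2\<in>S. t0 < t2"
      using that \<open>min t1 t \<in> S\<close> by (metis T_def empty_iff greaterThanLessThan_iff less_cSupE)
    then show ?thesis unfolding S_def by (blast intro: good_solution_mono less_imp_le)
  qed
  have "w analytic_on {of_real T}"
    using an by (rule analytic_on_subset) (use T t in auto)
  moreover have "T \<in> {s0<..<s1}" using T t by auto
  ultimately obtain e where e: "e > 0" "\<And>t1. t1 < T + e \<Longrightarrow> \<exists>X A. good_solution l w s0 a0 X A t1"
    using good_solution_extend[OF P3 \<open>0 < s0\<close> T(1) _ zero below] by blast
  have "T \<noteq> t" using e(1) e(2)[of T] neg by auto
  then have "T < t" using T by simp
  \<comment> \<open>A time beyond \<open>T\<close>, cut off at \<open>t\<close> to remain in
    \<open>S\<close>.\<close>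
  then have "min t (T + e / 2) \<in> S"
    using e(1) e(2)[of "min t (T + e / 2)"] T by (auto simp: S_def)
  then have "min t (T + e / 2) \<le> T" using bdd by (auto simp: T_def intro: cSup_upper)
  then show False using \<open>T < t\<close> e(1) by auto
qed

text \<open>Residue one becomes v' = 1 for the reciprocal of \<open>w\<close>, which allows the
  continuation across the pole; the continued \<chi> has its first zero after \<open>s0\<close>
  exactly at \<open>s1\<close>.\<close>

lemma return_at_pole:
  assumes P3: "meromorphic_P3_solution l w" and "0 < s0" "s0 < s1"
    and pole: "is_pole w (of_real s1)" "residue w (of_real s1) = 1"
    and sol: "\<And>t0. t0 \<in> {s0<..<s1} \<Longrightarrow> \<exists>X A. good_solution l w s0 a0 X A t0"
  obtains X A where "solves_system l X A {s0..s1}" "X s0 = 0" "A s0 = a0" "X s1 = 0"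
    "\<And>s. s \<in> {s0<..<s1} \<Longrightarrow> X s \<noteq> 0"
proof -
  have "s1 > 0" using assms by simp
  have "w meromorphic_on {of_real s1}"
    using P3 \<open>s1 > 0\<close> unfolding meromorphic_P3_solution_def nicely_meromorphic_on_def
    by (auto intro: meromorphic_on_subset)
  then obtain r v where r: "0 < r" "r \<le> s1" "v holomorphic_on ball (of_real s1) r" and v0: "v (of_real s1) = 0"
    and v_inv: "\<And>z. z \<in> ball (of_real s1) r \<Longrightarrow> z \<noteq> of_real s1 \<Longrightarrow> v z \<noteq> 0 \<and> w z = inverse (v z)"
    using pole_inverse_neighbourhood[OF _ pole(1) \<open>s1 > 0\<close>] by metis
  \<comment> \<open>Needed to know that the pole is simple, so that the residue is the inverse of
    \<open>deriv v\<close>; the sign is then decided by the residue.\<close>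
  have "(deriv v (of_real s1))\<^sup>2 = 1"
    by (rule P3_inverse_deriv_at_zero[OF P3 r(3,1,2) v_inv v0])
  then have "deriv v (of_real s1) \<noteq> 0" by auto
  from residue_of_inverse[OF r(3,1) v_inv v0 this] have dv: "deriv v (of_real s1) = 1"
    using pole(2) by (simp add: field_simps)
  define p where "p = max s0 (s1 - r)"
  define t0 where "t0 = (p + s1) / 2"
  have p: "s0 \<le> p" "s1 - r \<le> p" "p < t0" "t0 < s1"
    using \<open>s0 < s1\<close> r by (auto simp: p_def t0_def)
  obtain X A where g: "good_solution l w s0 a0 X A t0" using sol[of t0] p by auto
  then have tr: "traces l w X A {p<..<t0}"
    by (rule good_solution_traces) (use p in auto)
  have sub: "{p<..<t0} \<subseteq> {s1 - r<..<s1}" using p by auto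
  obtain Y B where Y: "solves_system l Y B {s1 - r<..<s1 + r}" "Y s1 = 0"
    and Y_nz: "\<And>s. s \<in> {s1 - r<..<s1} \<Longrightarrow> Y s \<noteq> 0"
    and eq: "\<And>s. s \<in> {p<..<t0} \<Longrightarrow> Y s = X s \<and> B s = A s"
    by (rule traces_continuation_pole[OF r(3,1,2) v_inv v0 dv p(3) sub tr]) blast+
  define m where "m = (p + t0) / 2"
  have m: "m \<in> {p<..<t0}" using p by (auto simp: m_def)
  let ?X = "\<lambda>s. if s < m then X s else Y s" and ?A = "\<lambda>s. if s < m then A s else B s"
  show thesis
  proof
    show "solves_system l ?X ?A {s0..s1}"
      by (rule solves_system_glue[of _ _ _ "{s0..t0}" _ _ "{s1 - r<..<s1 + r}" p t0])
         (use g Y eq m p r in \<open>auto simp: good_solution_def\<close>)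
    show "?X s0 = 0" "?A s0 = a0" "?X s1 = 0"
      using g m p Y(2) by (auto simp: good_solution_def)
    show "?X s \<noteq> 0" if "s \<in> {s0<..<s1}" for s
      using that g m p Y_nz[of s] by (auto simp: good_solution_def traces_def)
  qed
qed


section \<open>Behaviour of the function up to the first return\<close>

text \<open>As \<open>X t\<close> is nonzero, the real quotient is differentiable up to
  \<open>t\<close>, so \<open>w\<close> has a finite left limit and is analytic at \<open>t\<close>.
  Its derivative there equals the one-sided real one, which the Riccati-type equation makes -1 at a
  zero.\<close>

lemma traces_left_endpoint:
  assumes P3: "meromorphic_P3_solution l w" and "0 < s0" "s0 < t"
    and sol: "solves_system l X A {s0..t}" and "X t \<noteq> 0"
    and tr: "traces l w X A {s0<..<t}"
  shows "w analytic_on {of_real t}" "w (of_real t) = of_real (A t / (2 * t * X t))"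
    "w (of_real t) = 0 \<Longrightarrow> deriv w (of_real t) = - 1"
proof -
  define y where "y s = A s / (2 * s * X s)" for s
  have "(y has_real_derivative - 1 - (y t)\<^sup>2 + y t / t * (2 * l - 1 + 4 * X t * A t)) (at t within {s0..t})"
    unfolding y_def by (rule quotient_has_real_derivative[OF sol]) (use assms in auto)
  note dy = this
  have "((\<lambda>s. complex_of_real (y s)) \<longlongrightarrow> of_real (y t)) (at t within {s0..t})"
    using has_field_derivative_imp_has_derivative[OF dy, THEN has_derivative_continuous]
    by (intro tendsto_intros) (simp add: continuous_within)
  then have "((\<lambda>s. complex_of_real (y s)) \<longlongrightarrow> of_real (y t)) (at_left t)"
    using \<open>s0 < t\<close> by (simp add: at_within_Icc_at_left)
  moreover have "\<forall>\<^sub>F s in at_left t. complex_of_real (y s) = w (of_real s)"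
    using eventually_at_left_real[OF \<open>s0 < t\<close>]
    by eventually_elim (use tr in \<open>auto simp: traces_def y_def\<close>)
  ultimately have lim: "((\<lambda>s. w (of_real s)) \<longlongrightarrow> of_real (y t)) (at_left t)"
    by (rule Lim_transform_eventually)
  have "w nicely_meromorphic_on pos_axis" "of_real t \<in> pos_axis"
    using P3 assms by (auto simp: meromorphic_P3_solution_def)
  note * = nicely_meromorphic_left_limit[OF this lim]
  show an: "w analytic_on {of_real t}" by (rule *(1))
  show wt: "w (of_real t) = of_real (A t / (2 * t * X t))" using *(2) by (simp add: y_def)
  assume "w (of_real t) = 0"
  then have y0: "y t = 0" using *(2) by simp
  have "(w has_field_derivative deriv w (of_real t)) (at (of_real t))"
    using an by (meson analytic_at holomorphic_derivI)
  then have "deriv w (of_real t) = of_real (- 1 - (y t)\<^sup>2 + y t / t * (2 * l - 1 + 4 * X t * A t))"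
  proof (rule field_derivative_of_real_eq)
    show "(y has_real_derivative - 1 - (y t)\<^sup>2 + y t / t * (2 * l - 1 + 4 * X t * A t)) (at t within {s0<..t})"
      using dy by (rule has_field_derivative_subset) auto
    have "at t within {s0..t} = at t within {s0<..t}"
      by (rule at_within_nhd[of _ "{s0<..}"]) (use \<open>s0 < t\<close> in auto)
    then show "at t within {s0<..t} \<noteq> bot"
      using \<open>s0 < t\<close> by (metis at_within_Icc_at_left trivial_limit_at_left_real)
    show "w (of_real s) = of_real (y s)" if "s \<in> {s0<..t}" for s
      using that tr *(2) by (cases "s = t") (auto simp: traces_def y_def)
  qed (use \<open>s0 < t\<close> in auto)
  then show "deriv w (of_real t) = - 1" using y0 by simp
qed

text \<open>The real solution is given up to \<open>s1\<close>, but its relation to \<open>w\<close>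
  only near \<open>s0\<close>. If \<open>T\<close> is the supremum of times up to which the relation
  holds and \<open>T < s1\<close>, continuation along \<open>w\<close> across \<open>T\<close>
  yields another solution, which uniqueness identifies with the given one.\<close>

lemma traces_until_return:
  assumes P3: "meromorphic_P3_solution l w" and "0 < s0"
    and sol: "solves_system l X A {s0..s1}" and nz: "\<And>s. s \<in> {s0<..<s1} \<Longrightarrow> X s \<noteq> 0"
    and start: "traces l w X A {s0<..<t1}" "s0 < t1" "t1 \<le> s1"
  shows "traces l w X A {s0<..<s1}"
proof -
  define S where "S = {t. s0 < t \<and> t \<le> s1 \<and> traces l w X A {s0<..<t}}"
  have "t1 \<in> S" using start by (auto simp: S_def)
  have bdd: "bdd_above S" by (auto simp: S_def)
  define T where "T = Sup S"
  have T: "s0 < T" "T \<le> s1"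
  proof -
    show "s0 < T" using cSup_upper[OF \<open>t1 \<in> S\<close> bdd] start(2) by (simp add: T_def)
    show "T \<le> s1" unfolding T_def by (rule cSup_least) (use \<open>t1 \<in> S\<close> in \<open>auto simp: S_def\<close>)
  qed
  have "w (of_real s) = of_real (A s / (2 * s * X s))" if s: "s \<in> {s0<..<T}" for s
  proof -
    have "\<exists>t2\<in>S. s < t2"
      using s \<open>t1 \<in> S\<close> by (metis T_def empty_iff greaterThanLessThan_iff less_cSupE)
    then obtain t2 where "t2 \<in> S" "s < t2" by blast
    then show ?thesis using s by (auto simp: S_def traces_def)
  qed
  moreover have "solves_system l X A {s0<..<T}"
    using sol by (rule solves_system_subset) (use T in auto)
  ultimately have tr: "traces l w X A {s0<..<T}"
    unfolding traces_def using nz T by auto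
  have "T = s1"
  proof (rule ccontr)
    assume "T \<noteq> s1"
    then have "T < s1" using T by simp
    then have XT: "X T \<noteq> 0" using nz T by auto
    have "T > 0" using T \<open>0 < s0\<close> by simp
    have "solves_system l X A {s0..T}"
      using sol by (rule solves_system_subset) (use T in auto)
    note left = traces_left_endpoint[OF P3 \<open>0 < s0\<close> T(1) this XT tr]
    have freq: "\<exists>s\<in>{c<..<T}. w (of_real s) \<noteq> 0" if "c < T" for c
    proof -
      have "traces l w X A {max s0 c<..<T}" using tr by (rule traces_subset) auto
      from traces_frequently_nonzero[OF this] that T \<open>0 < s0\<close> show ?thesis by force
    qed
    obtain r where r: "0 < r" "r \<le> T" "w holomorphic_on ball (of_real T) r"
      and w_nz: "\<And>z. z \<in> ball (of_real T) r \<Longrightarrow> z \<noteq> of_real T \<Longrightarrow> w z \<noteq> 0"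
      using regular_neighbourhood[OF left(1) \<open>T > 0\<close> freq] by metis
    define p where "p = max s0 (T - r)"
    have p: "p < T" "s0 \<le> p" "T - r \<le> p" using T r by (auto simp: p_def)
    have sub: "{p<..<T} \<subseteq> {T - r<..<T}" using p by auto
    have trp: "traces l w X A {p<..<T}" using tr by (rule traces_subset) (use p in auto)
    obtain Y B where Y: "traces l w Y B {T - r<..<T + r}"
      and eq: "\<And>s. s \<in> {p<..<T} \<Longrightarrow> Y s = X s \<and> B s = A s"
      by (rule traces_continuation_regular[OF r(3,1,2) w_nz left(3) p(1) sub trp]) blast+
    define m where "m = (p + T) / 2"
    \<comment> \<open>Beyond \<open>T\<close>, yet inside both the ball of continuation and the
      given interval.\<close>
    define M where "M = min (T + r / 2) s1"
    have m: "p < m" "m < T" "m \<in> {m..M}" using p r T by (auto simp: m_def M_def)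
    have M: "T < M" "M \<le> s1" "M < T + r" using r \<open>T < s1\<close> by (auto simp: M_def)
    have "{m..M} \<subseteq> {T - r<..<T + r}" "{m..M} \<subseteq> {s0..s1}" using m M p by auto
    then have solY: "solves_system l Y B {m..M}" and solX: "solves_system l X A {m..M}"
      using Y sol solves_system_subset unfolding traces_def by blast+
    have "0 < m" using m p \<open>0 < s0\<close> by simp
    \<comment> \<open>The solutions agree at \<open>m\<close> to the left of \<open>T\<close>, so
      uniqueness carries the agreement across \<open>T\<close>.\<close>
    have XY: "X s = Y s" "A s = B s" if "s \<in> {m..M}" for s
      using solves_system_unique[OF solX solY \<open>0 < m\<close> m(3) _ _ that] eq[of m] m by auto
    have "w (of_real s) = of_real (A s / (2 * s * X s))" if s: "s \<in> {s0<..<M}" for s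
    proof (cases "s < T")
      case True
      then show ?thesis using tr s by (auto simp: traces_def)
    next
      case False
      then have "s \<in> {m..M}" "s \<in> {T - r<..<T + r}" using s m M r by auto
      then show ?thesis using Y XY[of s] by (auto simp: traces_def)
    qed
    moreover have "solves_system l X A {s0<..<M}"
      using sol by (rule solves_system_subset) (use M in auto)
    ultimately have "traces l w X A {s0<..<M}"
      unfolding traces_def using nz M by auto
    then have "M \<in> S" using M T by (auto simp: S_def)
    then have "M \<le> T" using bdd by (auto simp: T_def intro: cSup_upper)
    then show False using M by simp
  qed
  then show ?thesis using tr by simp
qed

lemma solves_system_zero: "solves_system l (\<lambda>_. 0) (\<lambda>_. 0) I"
  by (auto simp: solves_system_def)

text \<open>The reciprocal quotient \<open>y\<close> vanishes at \<open>s1\<close>, and its equation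
  gives y' = 1 there. Since w y = 1 just left of \<open>s1\<close> while y tends to 0,
  \<open>w\<close> has a pole; comparing \<open>y\<close> with the reciprocal of \<open>w\<close>
  from the left gives derivative 1, hence residue 1.\<close>

lemma pole_at_return:
  assumes P3: "meromorphic_P3_solution l w" and "0 < s0" "s0 < s1"
    and sol: "solves_system l X A {s0..s1}" and A: "A s1 \<noteq> 0" and X: "X s1 = 0"
    and tr: "traces l w X A {s0<..<s1}"
  shows "is_pole w (of_real s1)" "residue w (of_real s1) = 1"
proof -
  have "s1 > 0" using assms by simp
  have wm: "w nicely_meromorphic_on pos_axis" and "of_real s1 \<in> pos_axis"
    using P3 assms by (auto simp: meromorphic_P3_solution_def)
  define y where "y s = 2 * s * X s / A s" for s
  have dy: "(y has_real_derivative 1) (at s1 within {s0..s1})"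
    using inverse_quotient_has_real_derivative[OF sol _ \<open>s1 > 0\<close> A] X \<open>s0 < s1\<close> by (simp add: y_def[abs_def])
  have y1: "y s1 = 0" by (simp add: y_def X)
  have "((\<lambda>s. complex_of_real (y s)) \<longlongrightarrow> of_real (y s1)) (at s1 within {s0..s1})"
    using has_field_derivative_imp_has_derivative[OF dy, THEN has_derivative_continuous]
    by (intro tendsto_intros) (simp add: continuous_within)
  then have y_lim: "((\<lambda>s. complex_of_real (y s)) \<longlongrightarrow> 0) (at_left s1)"
    using \<open>s0 < s1\<close> by (simp add: at_within_Icc_at_left y1)
  \<comment> \<open>\<open>A\<close> must be nonzero near \<open>s1\<close> for the product of
    \<open>w\<close> and \<open>y\<close> to be 1 rather than a degenerate 0.\<close>
  have "(A \<longlongrightarrow> A s1) (at_left s1)"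
    using solves_system_continuous(2)[OF sol] \<open>s0 < s1\<close>
    by (auto simp: continuous_on_def at_within_Icc_at_left dest!: bspec[of _ _ s1])
  then have "\<forall>\<^sub>F s in at_left s1. A s \<noteq> 0"
    using A by (rule tendsto_imp_eventually_ne)
  then have wy: "\<forall>\<^sub>F s in at_left s1. A s \<noteq> 0 \<and> w (of_real s) * of_real (y s) = 1"
    using eventually_at_left_real[OF \<open>s0 < s1\<close>]
    by eventually_elim (use tr \<open>0 < s0\<close> in \<open>auto simp: traces_def y_def\<close>)
  show pole: "is_pole w (of_real s1)"
  proof (rule ccontr)
    assume "\<not> is_pole w (of_real s1)"
    then have "w analytic_on {of_real s1}"
      using wm \<open>of_real s1 \<in> pos_axis\<close> by (intro nicely_meromorphic_on_imp_analytic_at)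
    then have "(w \<longlongrightarrow> w (of_real s1)) (at (of_real s1))"
      using analytic_at_imp_isCont isContD by blast
    then have "((\<lambda>s. w (of_real s)) \<longlongrightarrow> w (of_real s1)) (at_left s1)"
      by (rule filterlim_compose[OF _ filterlim_of_real_at_left])
    from tendsto_mult[OF this y_lim]
    have "((\<lambda>s. w (of_real s) * of_real (y s)) \<longlongrightarrow> 0) (at_left s1)" by simp
    moreover have "\<forall>\<^sub>F s in at_left s1. w (of_real s) * of_real (y s) = 1"
      using wy by eventually_elim simp
    ultimately have "((\<lambda>s. 1 :: complex) \<longlongrightarrow> 0) (at_left s1)"
      by (rule Lim_transform_eventually)
    then show False by (simp add: tendsto_const_iff)
  qed
  have "w meromorphic_on {of_real s1}"
    using wm \<open>of_real s1 \<in> pos_axis\<close> unfolding nicely_meromorphic_on_def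
    by (auto intro: meromorphic_on_subset)
  then obtain r v where r: "0 < r" "r \<le> s1" "v holomorphic_on ball (of_real s1) r" and v0: "v (of_real s1) = 0"
    and v_inv: "\<And>z. z \<in> ball (of_real s1) r \<Longrightarrow> z \<noteq> of_real s1 \<Longrightarrow> v z \<noteq> 0 \<and> w z = inverse (v z)"
    using pole_inverse_neighbourhood[OF _ pole \<open>s1 > 0\<close>] by metis
  obtain b where b: "b < s1" "\<And>s. b < s \<Longrightarrow> s < s1 \<Longrightarrow> A s \<noteq> 0 \<and> w (of_real s) * of_real (y s) = 1"
    using wy by (auto simp: eventually_at_left[OF \<open>s0 < s1\<close>])
  \<comment> \<open>To the right of \<open>p\<close> the product relation, the trace interval and
    the ball are all available.\<close>
  define p where "p = max b (max s0 (s1 - r))"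
  have p: "p < s1" "b \<le> p" "s0 \<le> p" "s1 - r \<le> p" using b r \<open>s0 < s1\<close> by (auto simp: p_def)
  have "(v has_field_derivative deriv v (of_real s1)) (at (of_real s1))"
    using r by (auto intro: holomorphic_derivI)
  then have "deriv v (of_real s1) = of_real 1"
  proof (rule field_derivative_of_real_eq)
    show "(y has_real_derivative 1) (at s1 within {p<..s1})"
      using dy by (rule has_field_derivative_subset) (use p in auto)
    have "at s1 within {p..s1} = at s1 within {p<..s1}"
      by (rule at_within_nhd[of _ "{p<..}"]) (use p in auto)
    then show "at s1 within {p<..s1} \<noteq> bot"
      using p by (metis at_within_Icc_at_left trivial_limit_at_left_real)
    show "v (of_real s) = of_real (y s)" if "s \<in> {p<..s1}" for s
    proof (cases "s = s1")
      case False
      then have "w (of_real s) * of_real (y s) = 1" using that p by (intro b(2)[THEN conjunct2]) auto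
      moreover have "of_real s \<in> ball (complex_of_real s1) r"
        using that p by (auto simp: dist_of_real dist_real_def)
      then have "v (of_real s) \<noteq> 0 \<and> w (of_real s) = inverse (v (of_real s))"
        using False by (intro v_inv) auto
      ultimately show ?thesis by (simp add: field_simps)
    qed (simp add: v0 y1)
  qed (use p in auto)
  then show "residue w (of_real s1) = 1"
    using residue_of_inverse[OF r(3,1) v_inv v0] by simp
qed

section \<open>The equivalence: first return of \<chi> against the first pole of residue one\<close>

theorem proposition1p26:
  fixes l a0 s0 :: real
    and chi a :: "real \<Rightarrow> real" and J :: "real set"
    and w :: "complex \<Rightarrow> complex"
  assumes "a0 \<noteq> 0" and "s0 > 0"
    and "open J" and "is_interval J" and "J \<subseteq> {0<..}" and "s0 \<in> J"
    and "solves_system l chi a J" and "chi s0 = 0" and "a s0 = a0"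
    and "meromorphic_P3_solution l w"
    and "\<And>s. s \<in> J \<Longrightarrow> chi s \<noteq> 0 \<Longrightarrow> w (of_real s) = of_real (a s / (2 * s * chi s))"
  shows "poincare_well_defined_at (l, 0, a0, s0) \<longleftrightarrow>
    (\<exists>s1>s0.
       w analytic_on (complex_of_real ` {s0<..<s1}) \<and>
       is_pole w (of_real s1) \<and> residue w (of_real s1) = 1 \<and>
       \<not> (\<exists>s\<in>{s0<..<s1}. w (of_real s) = 0 \<and> deriv w (of_real s) = 1))"
proof -
  note P3 = \<open>meromorphic_P3_solution l w\<close>
  obtain e where e: "e > 0" "{s0..s0 + e} \<subseteq> J" and tr: "traces l w chi a {s0<..s0 + e}"
    using traces_near_start[of a s0 J l chi w] assms by blast
  have sol_e: "solves_system l chi a {s0..s0 + e}"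
    using assms(7) e(2) by (rule solves_system_subset)
  have well_defined: "poincare_well_defined_at (l, 0, a0, s0) \<longleftrightarrow>
      (\<exists>X A s1. s0 < s1 \<and> solves_system l X A {s0..s1} \<and> X s0 = 0 \<and> A s0 = a0 \<and> X s1 = 0 \<and>
         (\<forall>s\<in>{s0<..<s1}. X s \<noteq> 0))"
    using assms(1,2) unfolding poincare_well_defined_at_def poincare_graph_def Domain_iff Jos_o_def
    by auto
  show ?thesis
    unfolding well_defined
  proof (intro iffI; elim exE conjE)
    fix X A s1
    assume "s0 < s1" and sol: "solves_system l X A {s0..s1}" and init: "X s0 = 0" "A s0 = a0"
      and "X s1 = 0" and X_nz: "\<forall>s\<in>{s0<..<s1}. X s \<noteq> 0"
    \<comment> \<open>The pair \<open>X\<close>, \<open>A\<close> from the graph of the map is a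
      priori unrelated to \<open>chi\<close>, \<open>a\<close>. Uniqueness identifies them on this
      common initial interval, where \<open>w\<close> is known to be the quotient.\<close>
    define t1 where "t1 = min s1 (s0 + e)"
    have t1: "s0 < t1" "t1 \<le> s1" "t1 \<le> s0 + e" using \<open>s0 < s1\<close> e(1) by (auto simp: t1_def)
    have sol1: "solves_system l X A {s0..t1}" "solves_system l chi a {s0..t1}"
      by (rule solves_system_subset[OF sol], use t1 in force)
         (rule solves_system_subset[OF sol_e], use t1 in force)
    have eq: "X s = chi s" "A s = a s" if "s \<in> {s0..t1}" for s
      using solves_system_unique[OF sol1 \<open>s0 > 0\<close>, of s0 s] that t1 init assms(8,9) by auto
    have start: "traces l w X A {s0<..<t1}"
      unfolding traces_def
    proof (intro conjI ballI)
      show "solves_system l X A {s0<..<t1}"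
        using sol1(1) by (rule solves_system_subset) auto
      fix s assume s: "s \<in> {s0<..<t1}"
      then show "X s \<noteq> 0" "w (of_real s) = of_real (A s / (2 * s * X s))"
        using tr t1 eq[of s] by (auto simp: traces_def)
    qed
    have tr': "traces l w X A {s0<..<s1}"
      using X_nz by (intro traces_until_return[OF P3 \<open>s0 > 0\<close> sol _ start t1(1,2)]) auto
    have left: "w analytic_on {of_real t}" "w (of_real t) = 0 \<Longrightarrow> deriv w (of_real t) = - 1"
      if t: "t \<in> {s0<..<s1}" for t
    proof -
      have sol_t: "solves_system l X A {s0..t}"
        using sol by (rule solves_system_subset) (use t in auto)
      have tr_t: "traces l w X A {s0<..<t}"
        using tr' by (rule traces_subset) (use t in auto)
      have "s0 < t" "X t \<noteq> 0" using t X_nz by auto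
      note * = traces_left_endpoint[OF P3 \<open>s0 > 0\<close> this(1) sol_t this(2) tr_t]
      show "w analytic_on {of_real t}" by (rule *)
      show "w (of_real t) = 0 \<Longrightarrow> deriv w (of_real t) = - 1" by (rule *)
    qed
    \<comment> \<open>Otherwise the pair would meet the zero solution at \<open>s1\<close> and by
      uniqueness equal it back to \<open>s0\<close>, against \<open>a0 \<noteq> 0\<close>.\<close>
    have "A s1 \<noteq> 0"
      using solves_system_unique(2)[OF sol solves_system_zero \<open>s0 > 0\<close>, of s1 s0]
        \<open>X s1 = 0\<close> \<open>s0 < s1\<close> init assms(1) by auto
    note pole = pole_at_return[OF P3 \<open>s0 > 0\<close> \<open>s0 < s1\<close> sol this \<open>X s1 = 0\<close> tr']
    have "w analytic_on of_real ` {s0<..<s1}"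
      using left(1) analytic_on_analytic_at by blast
    moreover have "\<not> (\<exists>s\<in>{s0<..<s1}. w (of_real s) = 0 \<and> deriv w (of_real s) = 1)"
      using left(2) by fastforce
    ultimately show "\<exists>s1>s0. w analytic_on (complex_of_real ` {s0<..<s1}) \<and>
       is_pole w (of_real s1) \<and> residue w (of_real s1) = 1 \<and>
       \<not> (\<exists>s\<in>{s0<..<s1}. w (of_real s) = 0 \<and> deriv w (of_real s) = 1)"
      using pole \<open>s0 < s1\<close> by blast
  next
    fix s1
    assume "s0 < s1" and an: "w analytic_on (complex_of_real ` {s0<..<s1})"
      and pole: "is_pole w (of_real s1)" "residue w (of_real s1) = 1"
      and zero: "\<not> (\<exists>s\<in>{s0<..<s1}. w (of_real s) = 0 \<and> deriv w (of_real s) = 1)"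
    \<comment> \<open>\<open>s0 + e\<close> may exceed \<open>s1\<close>; the continuation argument
      starts from the smaller of \<open>s0 + e\<close> and its target time.\<close>
    have start: "good_solution l w s0 a0 chi a (s0 + e)"
      using sol_e tr assms(8,9) by (auto simp: good_solution_def traces_def)
    have "\<exists>X A. good_solution l w s0 a0 X A t" if "t \<in> {s0<..<s1}" for t
      by (rule good_solution_until[OF P3 \<open>s0 > 0\<close> \<open>s0 < s1\<close> an _ _ start that]) (use zero e(1) in auto)
    from return_at_pole[OF P3 \<open>s0 > 0\<close> \<open>s0 < s1\<close> pole this]
    obtain X A where "solves_system l X A {s0..s1}" "X s0 = 0" "A s0 = a0" "X s1 = 0"
      "\<And>s. s \<in> {s0<..<s1} \<Longrightarrow> X s \<noteq> 0" by blast
    then show "\<exists>X A s1. s0 < s1 \<and> solves_system l X A {s0..s1} \<and> X s0 = 0 \<and> A s0 = a0 \<and> X s1 = 0 \<and>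
         (\<forall>s\<in>{s0<..<s1}. X s \<noteq> 0)"
      using \<open>s0 < s1\<close> by blast
  qed
qed

end
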